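(* Let $(X,d)$ be a compact metric space, let $r>0$, and let $\varepsilon>0$ be such that an optimal covering of $X$ (a covering $Z\subseteq X$ with $|Z|=\mathcal{N}(X,r)$) determines a packing of balls with radius $\varepsilon$, i.e. is independent in the packing graph $P(X,\varepsilon)$. Then the covering hierarchy $\mathrm{las}^\gamma_t(C(X,r))$, $t=1,2,\ldots$ (defined with respect to this $\varepsilon$), gives a monotonically increasing sequence of lower bounds for the covering number $\mathcal{N}(X,r)$ and converges to the covering number in at most $\alpha(P(X,\varepsilon))$ steps: \[ \mathrm{las}^\gamma_1(C(X,r)) \leq \mathrm{las}^\gamma_2(C(X,r)) \leq \ldots \leq \mathrm{las}^\gamma_{\alpha(P(X,\varepsilon))}(C(X,r)) = \mathcal{N}(X,r). \]
   Context: Balls and coverings. $\overline{B}(x,s)=\{x'\in X: d(x,x')\le s\}$ and $B(x,s)=\{x'\in X: d(x,x')<s\}$. A set $Z\subseteq X$ is a covering of $X$ (for radius $r$) if $\bigcup_{z\in Z}\overline{B}(z,r)=X$. The covering number is $\mathcal{N}(X,r)=\min\{|Z| : Z\subseteq X,\ \bigcup_{z\in Z}\overline{B}(z,r)=X\}$, which is finite by compactness. The covering graph $C(X,r)$ has vertex set $X$, with $x,x'$ adjacent whenever $d(x,x')\le r$ (so $\mathcal{N}(X,r)$ is its domination number). Independent sets. The packing graph $P(X,\varepsilon)$ has vertex set $X$; two distinct points $x,x'$ are adjacent whenever $B(x,\varepsilon)\cap B(x',\varepsilon)\neq\emptyset$. A set is independent if it contains no pair of adjacent vertices; $\alpha(P(X,\varepsilon))$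 is the maximum cardinality of an independent set. For $t\ge 0$, $I_t$ is the set of all independent sets of $P(X,\varepsilon)$ with at most $t$ elements (including $\emptyset$), topologized by the Hausdorff distance on nonempty sets, with $\emptyset$ an isolated point. $I_{=1}$ is the set of independent sets of cardinality exactly $1$. Measures and kernels. $\mathcal{C}(Y)$ denotes the real-valued continuous functions on a compact space $Y$ with the supremum norm; its dual space is the space $\mathcal{M}(Y)$ of signed Radon measures, with pairing $\langle f,\mu\rangle=\int_Y f\,d\mu$. $\mathcal{M}(Y)_{\ge 0}$ is the cone of nonnegative Radon measures. $\mathcal{C}(I_t\times I_t)_{\mathrm{sym}}$ is the space of symmetric real-valued continuous kernels on $I_t\times I_t$, with dual space the symmetric signed Radon measures $\mathcal{M}(I_t\times I_t)_{\mathrm{sym}}$. $\mathcal{C}(I_t\times I_t)_{\succeq 0}$ is the cone of those $K\in\mathcal{C}(I_t\times I_t)_{\mathrm{sym}}$ that are positive definite, meaning that $(K(J_i,J_j))_{i,j=1}^m$ is positive semidefinite for all $m\in\mathbb{N}$ and $J_1,\ldots,J_m\in I_t$. $\mathcal{M}(I_t\times I_t)_{\succeq 0}$ is its dual cone, i.e. the set of $\mu\in\mathcal{M}(I_t\times I_t)_{\mathrm{sym}}$ with $\langle K,\mu\rangle\ge 0$ for all $K\in\mathcal{C}(I_t\times I_t)_{\succeq 0}$. Operators. The bounded linear operator $A_t:\mathcal{C}(I_t\times I_t)_{\mathrm{sym}}\to\mathcal{C}(I_{2t})$ is defined by \[A_tK(S)=\sum_{J,J'\in I_t:\ J\cup J'=S}K(J,J'),\]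 and for $z\in X$ the bounded linear operator $B^z_t:\mathcal{C}(I_t\times I_t)_{\mathrm{sym}}\to\mathcal{C}(I_{2t+2})$ is defined by \[B^z_tK(S)=\sum_{x\in\overline{B}(z,r),\ J,J'\in I_t:\ J\cup J'\cup\{x\}=S}K(J,J')-\sum_{J,J'\in I_t:\ J\cup J'=S}K(J,J').\] Their adjoint maps are $A_t^*:\mathcal{M}(I_{2t})\to\mathcal{M}(I_t\times I_t)_{\mathrm{sym}}$ and $(B^z_t)^*:\mathcal{M}(I_{2t+2})\to\mathcal{M}(I_t\times I_t)_{\mathrm{sym}}$, given by $\langle K,A_t^*\lambda\rangle=\langle A_tK,\lambda\rangle$ and $\langle K,(B^z_t)^*\lambda\rangle=\langle B^z_tK,\lambda\rangle$. Covering hierarchy. For $t=1,2,\ldots$, the $t$-th step is \[ \begin{split} \mathrm{las}^\gamma_t(C(X,r)) = \inf\Big\{\lambda(I_{=1}) \; : \; & \lambda \in \mathcal{M}(I_{2t})_{\geq 0},\ \lambda(\{\emptyset\}) = 1,\ A_t^*(\lambda) \in \mathcal{M}(I_t \times I_t)_{\succeq 0},\\ & (B^z_{t-1})^*(\lambda) \in \mathcal{M}(I_{t-1} \times I_{t-1})_{\succeq 0}\ \ (z \in X) \Big\}. \end{split} \] *)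

theory Defs
  imports "HOL-Analysis.Analysis"
begin

section \<open>Coverings and independent sets\<close>

definition is_covering :: "'a::metric_space set \<Rightarrow> real \<Rightarrow> 'a set \<Rightarrow> bool" where
  "is_covering X r Z \<longleftrightarrow> Z \<subseteq> X \<and> (\<Union>z\<in>Z. cball z r \<inter> X) = X"

definition covering_number :: "'a::metric_space set \<Rightarrow> real \<Rightarrow> nat" where
  "covering_number X r = (LEAST n. \<exists>Z. finite Z \<and> is_covering X r Z \<and> card Z = n)"

definition optimal_covering :: "'a::metric_space set \<Rightarrow> real \<Rightarrow> 'a set \<Rightarrow> bool" where
  "optimal_covering X r Z \<longleftrightarrow> finite Z \<and> is_covering X r Z \<and> card Z = covering_number X r"

text \<open>Balls are balls of the space \<open>X\<close>, so in the packing graph two balls are adjacent only if they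
  meet inside \<open>X\<close>.\<close>

definition packing_adjacent :: "'a::metric_space set \<Rightarrow> real \<Rightarrow> 'a \<Rightarrow> 'a \<Rightarrow> bool" where
  "packing_adjacent X \<epsilon> x y \<longleftrightarrow>
     x \<in> X \<and> y \<in> X \<and> x \<noteq> y \<and> (ball x \<epsilon> \<inter> X) \<inter> (ball y \<epsilon> \<inter> X) \<noteq> {}"

definition packing_independent :: "'a::metric_space set \<Rightarrow> real \<Rightarrow> 'a set \<Rightarrow> bool" where
  "packing_independent X \<epsilon> S \<longleftrightarrow> S \<subseteq> X \<and> (\<forall>x\<in>S. \<forall>y\<in>S. \<not> packing_adjacent X \<epsilon> x y)"

definition packing_alpha :: "'a::metric_space set \<Rightarrow> real \<Rightarrow> nat" where
  "packing_alpha X \<epsilon> = Max {card S |S. finite S \<and> packing_independent X \<epsilon> S}"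

definition indep_sets_upto :: "'a::metric_space set \<Rightarrow> real \<Rightarrow> nat \<Rightarrow> 'a set set" where
  "indep_sets_upto X \<epsilon> t = {S. finite S \<and> packing_independent X \<epsilon> S \<and> card S \<le> t}"

definition indep_singletons :: "'a::metric_space set \<Rightarrow> real \<Rightarrow> 'a set set" where
  "indep_singletons X \<epsilon> = {S. packing_independent X \<epsilon> S \<and> card S = 1}"

definition hausdorff_dist :: "'a::metric_space set \<Rightarrow> 'a set \<Rightarrow> real" where
  "hausdorff_dist S T = max (SUP x\<in>S. infdist x T) (SUP y\<in>T. infdist y S)"

definition indep_open :: "'a::metric_space set \<Rightarrow> real \<Rightarrow> nat \<Rightarrow> 'a set set \<Rightarrow> bool" where
  "indep_open X \<epsilon> t U \<longleftrightarrow> U \<subseteq> indep_sets_upto X \<epsilon> t \<and>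
     (\<forall>S\<in>U. S \<noteq> {} \<longrightarrow>
        (\<exists>\<delta>>0. \<forall>S'\<in>indep_sets_upto X \<epsilon> t. S' \<noteq> {} \<and> hausdorff_dist S S' < \<delta> \<longrightarrow> S' \<in> U))"

text \<open>No condition is imposed at \<open>{}\<close>, and \<open>{}\<close> is not required to belong to neighbourhoods of other
  points: the empty set is isolated.\<close>

definition indep_topology :: "'a::metric_space set \<Rightarrow> real \<Rightarrow> nat \<Rightarrow> 'a set topology" where
  "indep_topology X \<epsilon> t = topology (indep_open X \<epsilon> t)"

lemma istopology_indep_open: "istopology (indep_open X \<epsilon> t)"
  unfolding istopology_def
proof (intro conjI allI impI)
  fix U V assume U: "indep_open X \<epsilon> t U" and V: "indep_open X \<epsilon> t V"
  show "indep_open X \<epsilon> t (U \<inter> V)"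
    unfolding indep_open_def
  proof (intro conjI ballI impI)
    show "U \<inter> V \<subseteq> indep_sets_upto X \<epsilon> t"
      using U by (auto simp: indep_open_def)
    fix S assume S: "S \<in> U \<inter> V" "S \<noteq> {}"
    obtain a where a: "a > 0"
      "\<forall>S'\<in>indep_sets_upto X \<epsilon> t. S' \<noteq> {} \<and> hausdorff_dist S S' < a \<longrightarrow> S' \<in> U"
      using U S unfolding indep_open_def by blast
    obtain b where b: "b > 0"
      "\<forall>S'\<in>indep_sets_upto X \<epsilon> t. S' \<noteq> {} \<and> hausdorff_dist S S' < b \<longrightarrow> S' \<in> V"
      using V S unfolding indep_open_def by blast
    show "\<exists>\<delta>>0. \<forall>S'\<in>indep_sets_upto X \<epsilon> t.
            S' \<noteq> {} \<and> hausdorff_dist S S' < \<delta> \<longrightarrow> S' \<in> U \<inter> V"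
      by (rule exI[of _ "min a b"]) (use a b in auto)
  qed
next
  fix \<U> assume U: "\<forall>U\<in>\<U>. indep_open X \<epsilon> t U"
  show "indep_open X \<epsilon> t (\<Union>\<U>)"
    unfolding indep_open_def
  proof (intro conjI ballI impI)
    show "\<Union>\<U> \<subseteq> indep_sets_upto X \<epsilon> t"
      using U by (auto simp: indep_open_def)
    fix S assume "S \<in> \<Union>\<U>" and S: "S \<noteq> {}"
    then obtain W where W: "W \<in> \<U>" "S \<in> W" by blast
    then have "indep_open X \<epsilon> t W" using U by blast
    then obtain a where "a > 0"
      "\<forall>S'\<in>indep_sets_upto X \<epsilon> t. S' \<noteq> {} \<and> hausdorff_dist S S' < a \<longrightarrow> S' \<in> W"
      using W S unfolding indep_open_def by blast
    then show "\<exists>\<delta>>0. \<forall>S'\<in>indep_sets_upto X \<epsilon> t.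
                 S' \<noteq> {} \<and> hausdorff_dist S S' < \<delta> \<longrightarrow> S' \<in> \<Union>\<U>"
      using W by blast
  qed
qed

lemma openin_indep_topology: "openin (indep_topology X \<epsilon> t) U \<longleftrightarrow> indep_open X \<epsilon> t U"
  by (simp add: indep_topology_def istopology_indep_open)

lemma topspace_indep_topology: "topspace (indep_topology X \<epsilon> t) = indep_sets_upto X \<epsilon> t"
proof -
  have "indep_open X \<epsilon> t (indep_sets_upto X \<epsilon> t)"
    by (auto simp: indep_open_def intro: exI[of _ 1])
  then show ?thesis
    unfolding topspace_def openin_indep_topology by (auto simp: indep_open_def)
qed

section \<open>Radon measures on a compact space\<close>

definition borel_sets_of :: "'b topology \<Rightarrow> 'b set set" where
  "borel_sets_of T = sigma_sets (topspace T) {U. openin T U}"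

definition radon_measures :: "'b topology \<Rightarrow> 'b measure set" where
  "radon_measures T = {M. space M = topspace T \<and> sets M = borel_sets_of T \<and> finite_measure M \<and>
     (\<forall>E\<in>sets M. emeasure M E = (SUP C\<in>{C. compactin T C \<and> C \<subseteq> E}. emeasure M C))}"

text \<open>A signed Radon measure is the difference of two nonnegative ones, as a real set function on the
  Borel sets (\<^const>\<open>measure\<close> is \<open>0\<close> outside them). Its integral does not depend on the chosen pair, see
  \<open>signed_integral_eq\<close>.\<close>

definition signed_radon_measures :: "'b topology \<Rightarrow> ('b set \<Rightarrow> real) set" where
  "signed_radon_measures T =
     {(\<lambda>E. measure M E - measure N E) |M N. M \<in> radon_measures T \<and> N \<in> radon_measures T}"

definition signed_integral :: "'b topology \<Rightarrow> ('b \<Rightarrow> real) \<Rightarrow> ('b set \<Rightarrow> real) \<Rightarrow> real" where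
  "signed_integral T f \<nu> = (THE I. \<exists>M\<in>radon_measures T. \<exists>N\<in>radon_measures T.
     \<nu> = (\<lambda>E. measure M E - measure N E) \<and> I = integral\<^sup>L M f - integral\<^sup>L N f)"

lemma signed_integral_unique:
  fixes f :: "'b \<Rightarrow> real" and B :: real
  assumes M: "M \<in> radon_measures T" "M' \<in> radon_measures T"
    and N: "N \<in> radon_measures T" "N' \<in> radon_measures T"
    and eq: "(\<lambda>E. measure M E - measure N E) = (\<lambda>E. measure M' E - measure N' E)"
    and f: "f \<in> borel_measurable M" and bd: "\<And>x. x \<in> topspace T \<Longrightarrow> \<bar>f x\<bar> \<le> B"
  shows "integral\<^sup>L M f - integral\<^sup>L N f = integral\<^sup>L M' f - integral\<^sup>L N' f"
proof -
  interpret M: finite_measure M using M by (simp add: radon_measures_def)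
  interpret M': finite_measure M' using M by (simp add: radon_measures_def)
  interpret N: finite_measure N using N by (simp add: radon_measures_def)
  interpret N': finite_measure N' using N by (simp add: radon_measures_def)
  have sp: "space M = topspace T" "space M' = topspace T" "space N = topspace T" "space N' = topspace T"
    and [measurable_cong]: "sets M' = sets M" "sets N = sets M" "sets N' = sets M"
    using M N by (auto simp: radon_measures_def)
  have em: "emeasure M E + emeasure N' E = emeasure M' E + emeasure N E" for E
  proof -
    have "measure M E + measure N' E = measure M' E + measure N E"
      using fun_cong[OF eq, of E] by simp
    then show ?thesis
      by (simp add: M.emeasure_eq_measure M'.emeasure_eq_measure N.emeasure_eq_measure
          N'.emeasure_eq_measure flip: ennreal_plus)
  qed
  have nn: "(\<integral>\<^sup>+x. g x \<partial>M) + (\<integral>\<^sup>+x. g x \<partial>N') = (\<integral>\<^sup>+x. g x \<partial>M') + (\<integral>\<^sup>+x. g x \<partial>N)"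
    if "g \<in> borel_measurable M" for g
    using that
  proof (induction rule: borel_measurable_induct)
    case (cong f g)
    have "nn_integral K f = nn_integral K g" if "space K = topspace T" for K
      by (rule nn_integral_cong) (use cong(3) that sp in auto)
    then show ?case using cong sp by simp
  next
    case (set A)
    then show ?case using em by simp
  next
    case (mult u c)
    have [measurable]: "u \<in> borel_measurable M" by fact
    show ?case
      using mult.IH by (simp add: nn_integral_cmult flip: distrib_left)
  next
    case (add u v)
    have [measurable]: "u \<in> borel_measurable M" "v \<in> borel_measurable M" by fact+
    show ?case
      using add.IH by (simp add: nn_integral_add) (metis (no_types, lifting) add.assoc add.commute)
  next
    case (seq U)
    have [measurable]: "\<And>i. U i \<in> borel_measurable M" by fact
    have K: "nn_integral K (\<lambda>x. (SUP i. U i) x) = (SUP i. nn_integral K (U i))"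
      if [measurable_cong]: "sets K = sets M" for K
      unfolding SUP_apply by (rule nn_integral_monotone_convergence_SUP) (use seq in auto)
    have mono: "incseq (\<lambda>i. nn_integral K (U i))" for K
      using seq(3) by (auto simp: mono_def le_fun_def intro!: nn_integral_mono)
    have KK: "nn_integral K (\<lambda>x. (SUP i. U i) x) + nn_integral L (\<lambda>x. (SUP i. U i) x)
        = (SUP i. nn_integral K (U i) + nn_integral L (U i))"
      if "sets K = sets M" "sets L = sets M" for K L
      unfolding K[OF that(1)] K[OF that(2)] by (rule ennreal_SUP_add[OF mono mono, symmetric])
    have "(\<lambda>i. nn_integral M (U i) + nn_integral N' (U i)) = (\<lambda>i. nn_integral M' (U i) + nn_integral N (U i))"
      using seq.IH by auto
    then have *: "(SUP i. nn_integral M (U i) + nn_integral N' (U i))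
        = (SUP i. nn_integral M' (U i) + nn_integral N (U i))"
      by (rule arg_cong[where f = "\<lambda>h. SUP i. h i"])
    show ?case
      by (rule trans[OF KK[OF refl \<open>sets N' = sets M\<close>]
            trans[OF * KK[OF \<open>sets M' = sets M\<close> \<open>sets N = sets M\<close>, symmetric]]])
  qed
  have int: "integrable K f \<and> ennreal (integral\<^sup>L K f + B * measure K (topspace T)) = (\<integral>\<^sup>+x. ennreal (f x + B) \<partial>K)
               \<and> 0 \<le> integral\<^sup>L K f + B * measure K (topspace T)"
    if "finite_measure K" "space K = topspace T" "sets K = sets M" for K
  proof -
    interpret finite_measure K by fact
    have [measurable]: "f \<in> borel_measurable K" using f that(3) by (simp cong: measurable_cong_sets)
    have i: "integrable K f"
      by (rule integrable_const_bound[of _ B]) (use bd that(2) in auto)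
    have e: "integral\<^sup>L K (\<lambda>x. f x + B) = integral\<^sup>L K f + B * measure K (topspace T)"
      using i by (simp add: that(2))
    have nn: "f x + B \<ge> 0" if "x \<in> space K" for x
      using bd[of x] that \<open>space K = topspace T\<close> by auto
    have "(\<integral>\<^sup>+x. ennreal (f x + B) \<partial>K) = ennreal (integral\<^sup>L K (\<lambda>x. f x + B))"
      by (rule nn_integral_eq_integral) (use i nn in auto)
    moreover have "0 \<le> integral\<^sup>L K (\<lambda>x. f x + B)"
      by (rule integral_nonneg_AE) (use nn in auto)
    ultimately show ?thesis using i e by simp
  qed
  have "(\<lambda>x. ennreal (f x + B)) \<in> borel_measurable M" using f by measurable
  from nn[OF this]
  have "ennreal (integral\<^sup>L M f + B * measure M (topspace T)) + ennreal (integral\<^sup>L N' f + B * measure N' (topspace T))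
    = ennreal (integral\<^sup>L M' f + B * measure M' (topspace T)) + ennreal (integral\<^sup>L N f + B * measure N (topspace T))"
    using int M.finite_measure_axioms M'.finite_measure_axioms N.finite_measure_axioms
      N'.finite_measure_axioms sp \<open>sets M' = sets M\<close> \<open>sets N = sets M\<close> \<open>sets N' = sets M\<close> by simp
  moreover have "0 \<le> integral\<^sup>L K f + B * measure K (topspace T)" if "K \<in> {M, M', N, N'}" for K
    using that int M.finite_measure_axioms M'.finite_measure_axioms N.finite_measure_axioms
      N'.finite_measure_axioms sp \<open>sets M' = sets M\<close> \<open>sets N = sets M\<close> \<open>sets N' = sets M\<close> by blast
  ultimately have "(integral\<^sup>L M f + B * measure M (topspace T)) + (integral\<^sup>L N' f + B * measure N' (topspace T))
    = (integral\<^sup>L M' f + B * measure M' (topspace T)) + (integral\<^sup>L N f + B * measure N (topspace T))"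
    by (simp flip: ennreal_plus)
  moreover have "B * measure M (topspace T) - B * measure N (topspace T)
      = B * measure M' (topspace T) - B * measure N' (topspace T)"
    using fun_cong[OF eq, of "topspace T"] by (metis right_diff_distrib)
  ultimately show ?thesis by linarith
qed

lemma signed_integral_eq:
  assumes T: "compact_space T" and f: "continuous_map T euclideanreal f"
    and M: "M \<in> radon_measures T" and N: "N \<in> radon_measures T"
  shows "signed_integral T f (\<lambda>E. measure M E - measure N E) = integral\<^sup>L M f - integral\<^sup>L N f"
proof -
  have meas: "f \<in> borel_measurable M"
  proof (rule borel_measurableI)
    fix U :: "real set" assume "open U"
    then have "openin T {x \<in> topspace T. f x \<in> U}"
      using f by (simp add: openin_continuous_map_preimage)
    moreover have "f -` U \<inter> space M = {x \<in> topspace T. f x \<in> U}"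
      using M by (auto simp: radon_measures_def)
    ultimately show "f -` U \<inter> space M \<in> sets M"
      using M by (auto simp: radon_measures_def borel_sets_of_def)
  qed
  obtain B where bd: "\<And>x. x \<in> topspace T \<Longrightarrow> \<bar>f x\<bar> \<le> B"
  proof -
    have "compactin euclideanreal (f ` topspace T)"
      using T f by (metis compact_space_def image_compactin)
    then have "bounded (f ` topspace T)"
      by (simp add: compact_imp_bounded)
    then show ?thesis using that by (auto simp: bounded_iff)
  qed
  have "I = integral\<^sup>L M f - integral\<^sup>L N f"
    if "M' \<in> radon_measures T" "N' \<in> radon_measures T" "I = integral\<^sup>L M' f - integral\<^sup>L N' f"
      "(\<lambda>E. measure M E - measure N E) = (\<lambda>E. measure M' E - measure N' E)" for M' N' I
    using signed_integral_unique[OF M that(1) N that(2) that(4) meas bd] that(3) by linarith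
  then show ?thesis
    unfolding signed_integral_def
    by (intro the_equality bexI[OF _ M] bexI[OF _ N] conjI refl) (elim bexE conjE, simp)
qed

section \<open>Kernels, dual cones and adjoints\<close>

definition sym_kernels :: "'b topology \<Rightarrow> ('b \<times> 'b \<Rightarrow> real) set" where
  "sym_kernels T = {K. continuous_map (prod_topology T T) euclideanreal K \<and>
     (\<forall>J\<in>topspace T. \<forall>J'\<in>topspace T. K (J, J') = K (J', J))}"

definition psd_kernels :: "'b topology \<Rightarrow> ('b \<times> 'b \<Rightarrow> real) set" where
  "psd_kernels T = {K \<in> sym_kernels T. \<forall>m. \<forall>J::nat \<Rightarrow> 'b. (\<forall>i<m. J i \<in> topspace T) \<longrightarrow>
     (\<forall>c::nat \<Rightarrow> real. 0 \<le> (\<Sum>i<m. \<Sum>j<m. c i * c j * K (J i, J j)))}"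

definition sym_radon_measures :: "'b topology \<Rightarrow> (('b \<times> 'b) set \<Rightarrow> real) set" where
  "sym_radon_measures T = {\<nu> \<in> signed_radon_measures (prod_topology T T).
     \<forall>E\<in>borel_sets_of (prod_topology T T). \<nu> (prod.swap ` E) = \<nu> E}"

definition psd_measures :: "'b topology \<Rightarrow> (('b \<times> 'b) set \<Rightarrow> real) set" where
  "psd_measures T = {\<nu> \<in> sym_radon_measures T.
     \<forall>K\<in>psd_kernels T. 0 \<le> signed_integral (prod_topology T T) K \<nu>}"

text \<open>\<open>is_adjoint_image T A \<lambda> \<nu>\<close> says that \<open>\<nu>\<close> is the image of \<open>\<lambda>\<close> under the adjoint of the operator
  \<open>A\<close> from symmetric kernels on \<open>T\<close>. For \<open>T\<close> compact metrizable and \<open>A\<close> bounded, Riesz representation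
  gives exactly one such \<open>\<nu>\<close>.\<close>

definition is_adjoint_image ::
  "'b topology \<Rightarrow> (('b \<times> 'b \<Rightarrow> real) \<Rightarrow> 'c \<Rightarrow> real) \<Rightarrow> 'c measure \<Rightarrow> (('b \<times> 'b) set \<Rightarrow> real) \<Rightarrow> bool"
where
  "is_adjoint_image T A lam \<nu> \<longleftrightarrow> \<nu> \<in> sym_radon_measures T \<and>
     (\<forall>K\<in>sym_kernels T. signed_integral (prod_topology T T) K \<nu> = (\<integral>S. A K S \<partial>lam))"

section \<open>The covering hierarchy\<close>

definition A_op :: "'a::metric_space set \<Rightarrow> real \<Rightarrow> nat \<Rightarrow> ('a set \<times> 'a set \<Rightarrow> real) \<Rightarrow> 'a set \<Rightarrow> real"
where
  "A_op X \<epsilon> t K S =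
     (\<Sum>(J, J') \<in> {(J, J'). J \<in> indep_sets_upto X \<epsilon> t \<and> J' \<in> indep_sets_upto X \<epsilon> t \<and> J \<union> J' = S}.
        K (J, J'))"

text \<open>Since the closed ball need not be open, \<open>B_op X r \<epsilon> t z K\<close> is in general only a bounded Borel
  function for continuous \<open>K\<close>; it is paired with measures by integration.\<close>

definition B_op ::
  "'a::metric_space set \<Rightarrow> real \<Rightarrow> real \<Rightarrow> nat \<Rightarrow> 'a \<Rightarrow> ('a set \<times> 'a set \<Rightarrow> real) \<Rightarrow> 'a set \<Rightarrow> real"
where
  "B_op X r \<epsilon> t z K S =
     (\<Sum>(x, J, J') \<in> {(x, J, J'). x \<in> cball z r \<inter> X \<and>
          J \<in> indep_sets_upto X \<epsilon> t \<and> J' \<in> indep_sets_upto X \<epsilon> t \<and> J \<union> J' \<union> {x} = S}.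
        K (J, J'))
   - (\<Sum>(J, J') \<in> {(J, J'). J \<in> indep_sets_upto X \<epsilon> t \<and> J' \<in> indep_sets_upto X \<epsilon> t \<and> J \<union> J' = S}.
        K (J, J'))"

definition las_feasible :: "'a::metric_space set \<Rightarrow> real \<Rightarrow> real \<Rightarrow> nat \<Rightarrow> 'a set measure set" where
  "las_feasible X r \<epsilon> t = {lam \<in> radon_measures (indep_topology X \<epsilon> (2 * t)).
     measure lam {{}} = 1 \<and>
     (\<exists>\<nu>\<in>psd_measures (indep_topology X \<epsilon> t).
        is_adjoint_image (indep_topology X \<epsilon> t) (A_op X \<epsilon> t) lam \<nu>) \<and>
     (\<forall>z\<in>X. \<exists>\<nu>\<in>psd_measures (indep_topology X \<epsilon> (t - 1)).
        is_adjoint_image (indep_topology X \<epsilon> (t - 1)) (B_op X r \<epsilon> (t - 1) z) lam \<nu>)}"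

text \<open>The steps are \<open>t = 1, 2, \<dots>\<close>. The value at \<open>t = 0\<close> only plays a role for \<open>X = {}\<close>, where the
  second family of constraints is empty.\<close>

definition las :: "'a::metric_space set \<Rightarrow> real \<Rightarrow> real \<Rightarrow> nat \<Rightarrow> ereal" where
  "las X r \<epsilon> t = (INF lam\<in>las_feasible X r \<epsilon> t. ereal (measure lam (indep_singletons X \<epsilon>)))"

end

theory Submission
  imports Defs
begin

text \<open>Every operator of the hierarchy is a Moebius transform. For a finite independent set \<open>S\<close>, summing
\<open>A_op K\<close> over the subsets of \<open>S\<close> counts each pair \<open>J, J' \<subseteq> S\<close> once, and summing \<open>B_op K\<close> counts it
\<open>card (S \<inter> cball z r) - 1\<close> times. So, with \<open>pair_sum K R\<close> the sum of \<open>K\<close> over the pairs of small subsets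
of \<open>R\<close>, \<open>A_op K\<close> is the Moebius transform of \<open>pair_sum K\<close> and \<open>B_op K\<close> that of
\<open>R \<mapsto> (card (R \<inter> cball z r) - 1) * pair_sum K R\<close>. The natural object is therefore the functional
\<open>\<Lambda> \<psi> = \<integral> mobius \<psi> d\<lambda>\<close>: it integrates \<open>\<psi>\<close> against the signed measure \<open>\<sigma>\<close> with
\<open>\<lambda> = \<integral> \<chi>\<^sub>R d\<sigma>(R)\<close>, where \<open>\<chi>\<^sub>R\<close> is the sum of the point masses at the subsets of \<open>R\<close>. In these terms
\<open>\<Lambda> 1 = \<lambda> {{}}\<close> and \<open>\<Lambda> card\<close> is the objective value.

Upper bound (\<open>las_le_card\<close>): for an independent covering \<open>Z\<close> the truncation of \<open>\<chi>\<^sub>Z\<close> to sets of size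
at most \<open>2 t\<close> is feasible. Its images under the adjoints are nonnegative multiples of the sum of point
masses at pairs of small subsets of \<open>Z\<close>; for the second family the factor
\<open>card (Z \<inter> cball z r) - 1\<close> is nonnegative exactly because \<open>Z\<close> covers \<open>z\<close>.

Monotonicity (\<open>las_mono\<close>): the sets of size at most \<open>2 s\<close> form a clopen part of the larger space, and a
feasible measure of step \<open>t\<close> restricts to a feasible measure of step \<open>s\<close>, since kernels on the smaller
space extend by zero.

Exactness (\<open>covering_number_le_measure\<close>): let \<open>a\<close> be the packing number, so that all independent sets
have at most \<open>a\<close> points. Each continuous \<open>\<psi> \<ge> 0\<close> is \<open>pair_sum K\<close> for the rank one kernel \<open>K\<close> built from
the Moebius transform of \<open>sqrt \<psi>\<close>, so the first constraint makes \<open>\<Lambda>\<close> positive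
(\<open>mobius_integral_nonneg\<close>). The second constraint is available only for kernels on sets of size at most
\<open>a - 1\<close>, but this suffices: the coefficients \<open>(-1) ^ j * (1 - j / a)\<close> vanish at \<open>j = a\<close>, and the rank one
kernel they define turns \<open>(card (R \<inter> C) - 1) * pair_sum K R\<close> into \<open>-1\<close> if \<open>R \<inter> C = {}\<close> and into \<open>0\<close>
otherwise, where \<open>C = cball z r\<close>. Hence \<open>\<Lambda>\<close> gives no weight to sets that miss \<open>C\<close>
(\<open>mobius_integral_uncovered_nonpos\<close>). As every \<open>R\<close> with fewer than \<open>covering_number X r\<close> points
misses some ball, compactness of the space of independent sets yields
\<open>card R - covering_number X r + (functions that \<Lambda> makes nonpositive) > - e\<close> uniformly in \<open>R\<close>, and
applying \<open>\<Lambda>\<close> gives the lower bound up to \<open>e\<close>.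

Since closed balls are not open, their indicators are reached as limits of continuous functions, by
dominated convergence.\<close>

section \<open>Moebius inversion on finite sets\<close>

definition mobius :: "('a set \<Rightarrow> real) \<Rightarrow> 'a set \<Rightarrow> real" where
  "mobius \<psi> S = (\<Sum>R\<in>Pow S. (-1) ^ (card S + card R) * \<psi> R)"

lemma sum_mobius:
  assumes "finite S"
  shows "(\<Sum>R\<in>Pow S. mobius \<psi> R) = \<psi> S"
proof -
  have "\<psi> S = (\<Sum>T\<in>Pow S. (-1) ^ card T * (\<Sum>R\<in>Pow T. (-1) ^ card R * \<psi> R))"
    by (rule inclusion_exclusion_symmetric[OF refl assms])
  then show ?thesis
    by (simp add: mobius_def sum_distrib_left power_add mult.assoc)
qed

lemma mobius_unique:
  assumes "finite S" and "\<And>R. R \<subseteq> S \<Longrightarrow> (\<Sum>U\<in>Pow R. a U) = \<psi> R"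
  shows "a S = mobius \<psi> S"
proof -
  have "a S = (\<Sum>T\<in>Pow S. (-1) ^ (card S - card T) * sum a (Pow T))"
    by (rule inclusion_exclusion_mobius[OF refl assms(1)])
  also have "\<dots> = mobius \<psi> S"
    unfolding mobius_def using assms
    by (intro sum.cong) (auto simp: card_mono neg_one_power_add_eq_neg_one_power_diff)
  finally show ?thesis .
qed

lemma mobius_cong:
  assumes "\<And>R. R \<subseteq> S \<Longrightarrow> \<phi> R = \<psi> R"
  shows "mobius \<phi> S = mobius \<psi> S"
  using assms by (auto simp: mobius_def intro!: sum.cong)

lemma abs_mobius_le:
  assumes "finite S" "\<And>R. R \<subseteq> S \<Longrightarrow> \<bar>\<psi> R\<bar> \<le> b"
  shows "\<bar>mobius \<psi> S\<bar> \<le> 2 ^ card S * b"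
proof -
  have "\<bar>mobius \<psi> S\<bar> \<le> (\<Sum>R\<in>Pow S. b)"
    unfolding mobius_def using assms(2)
    by (intro order_trans[OF sum_abs] sum_mono) (auto simp: abs_mult power_abs)
  then show ?thesis by (simp add: card_Pow assms)
qed

lemma mobius_one: "finite S \<Longrightarrow> mobius (\<lambda>R. 1) S = of_bool (S = {})"
  by (rule mobius_unique[symmetric]) (auto dest: finite_subset simp: of_bool_def sum.If_cases)

lemma mobius_card: "finite S \<Longrightarrow> mobius (\<lambda>R. real (card R)) S = of_bool (card S = 1)"
proof (rule mobius_unique[symmetric])
  fix R assume "R \<subseteq> S" "finite S"
  then have "finite R" by (auto dest: finite_subset)
  have "{U. U \<subseteq> R \<and> card U = 1} = (\<lambda>x. {x}) ` R"
    by (auto simp: card_1_singleton_iff)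
  moreover have "inj_on (\<lambda>x. {x}) R" by auto
  ultimately have "card {U. U \<subseteq> R \<and> card U = 1} = card R"
    by (metis card_image)
  moreover have "{U \<in> Pow R. card U = 1} = {U. U \<subseteq> R \<and> card U = 1}" by auto
  ultimately show "(\<Sum>U\<in>Pow R. of_bool (card U = 1)) = real (card R)"
    using \<open>finite R\<close> by (simp add: of_bool_def sum.If_cases Int_def)
qed

lemma mobius_add: "mobius (\<lambda>R. \<phi> R + \<psi> R) S = mobius \<phi> S + mobius \<psi> S"
  by (simp add: mobius_def algebra_simps sum.distrib)

lemma mobius_cmult: "mobius (\<lambda>R. c * \<psi> R) S = c * mobius \<psi> S"
  by (simp add: mobius_def algebra_simps sum_distrib_left)

lemma mobius_sum: "mobius (\<lambda>R. \<Sum>p\<in>P. \<psi> p R) S = (\<Sum>p\<in>P. mobius (\<psi> p) S)"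
  unfolding mobius_def by (simp only: sum_distrib_left) (rule sum.swap)

text \<open>The index set of the two operators: the members of \<open>indep_sets_upto X \<epsilon> t\<close> inside an independent
set \<open>R\<close> are exactly these.\<close>

definition small_subsets :: "nat \<Rightarrow> 'a set \<Rightarrow> 'a set set" where
  "small_subsets t R = {J. J \<subseteq> R \<and> card J \<le> t}"

definition pair_sum :: "nat \<Rightarrow> ('a set \<times> 'a set \<Rightarrow> real) \<Rightarrow> 'a set \<Rightarrow> real" where
  "pair_sum t K R = (\<Sum>J\<in>small_subsets t R. \<Sum>J'\<in>small_subsets t R. K (J, J'))"

lemma finite_small_subsets: "finite R \<Longrightarrow> finite (small_subsets t R)"
  by (simp add: small_subsets_def)

lemma pair_sum_rank_one:
  "pair_sum t (\<lambda>(J, J'). f J * f J') R = (\<Sum>J\<in>small_subsets t R. f J)\<^sup>2"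
  by (simp add: pair_sum_def power2_eq_square sum_product)

lemma packing_independent_subset:
  "packing_independent X \<epsilon> S \<Longrightarrow> R \<subseteq> S \<Longrightarrow> packing_independent X \<epsilon> R"
  by (auto simp: packing_independent_def)

text \<open>Each pair of small subsets of \<open>Z\<close> is counted once, at its union. The family \<open>\<S>\<close> is a parameter
because two choices are needed: all subsets of \<open>Z\<close>, for Moebius inversion, and the subsets of size at
most \<open>2 t\<close>, for the feasible measure of a covering.\<close>

lemma sum_A_op:
  assumes Z: "finite Z" "packing_independent X \<epsilon> Z"
    and S: "\<S> \<subseteq> Pow Z"
    and un: "\<And>J J'. J \<in> small_subsets t Z \<Longrightarrow> J' \<in> small_subsets t Z \<Longrightarrow> J \<union> J' \<in> \<S>"
  shows "(\<Sum>S\<in>\<S>. A_op X \<epsilon> t K S) = pair_sum t K Z"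
proof -
  let ?Q = "small_subsets t Z"
  have fin: "finite \<S>" using S Z by (meson finite_Pow_iff finite_subset)
  have "A_op X \<epsilon> t K S = sum K {p \<in> ?Q \<times> ?Q. (case p of (J, J') \<Rightarrow> J \<union> J') = S}" if "S \<in> \<S>" for S
  proof -
    have "S \<subseteq> Z" using that S by auto
    then have "{(J, J'). J \<in> indep_sets_upto X \<epsilon> t \<and> J' \<in> indep_sets_upto X \<epsilon> t \<and> J \<union> J' = S}
        = {p \<in> ?Q \<times> ?Q. (case p of (J, J') \<Rightarrow> J \<union> J') = S}"
      using Z by (auto simp: indep_sets_upto_def small_subsets_def
          intro: packing_independent_subset finite_subset)
    then show ?thesis unfolding A_op_def by (simp add: case_prod_beta)
  qed
  then have "(\<Sum>S\<in>\<S>. A_op X \<epsilon> t K S)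
      = (\<Sum>S\<in>\<S>. sum K {p \<in> ?Q \<times> ?Q. (case p of (J, J') \<Rightarrow> J \<union> J') = S})"
    by simp
  also have "\<dots> = sum K (?Q \<times> ?Q)"
    by (rule sum.group) (use fin Z un in \<open>auto intro!: finite_cartesian_product finite_small_subsets\<close>)
  also have "\<dots> = pair_sum t K Z"
    by (simp add: pair_sum_def sum.cartesian_product)
  finally show ?thesis .
qed

text \<open>Each pair is counted once for every \<open>x \<in> Z \<inter> cball z r\<close>, at the set \<open>J \<union> J' \<union> {x}\<close>, and is subtracted
once.\<close>

lemma sum_B_op:
  assumes Z: "finite Z" "packing_independent X \<epsilon> Z"
    and S: "\<S> \<subseteq> Pow Z"
    and un: "\<And>J J'. J \<in> small_subsets t Z \<Longrightarrow> J' \<in> small_subsets t Z \<Longrightarrow> J \<union> J' \<in> \<S>"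
    and un': "\<And>x J J'. x \<in> Z \<Longrightarrow> J \<in> small_subsets t Z \<Longrightarrow> J' \<in> small_subsets t Z \<Longrightarrow> J \<union> J' \<union> {x} \<in> \<S>"
  shows "(\<Sum>S\<in>\<S>. B_op X r \<epsilon> t z K S) = (real (card (Z \<inter> cball z r)) - 1) * pair_sum t K Z"
proof -
  let ?Q = "small_subsets t Z" and ?C = "Z \<inter> cball z r"
  have fin: "finite \<S>" using S Z by (meson finite_Pow_iff finite_subset)
  have "Z \<subseteq> X" using Z by (simp add: packing_independent_def)
  let ?P = "\<lambda>S. {p \<in> ?C \<times> ?Q \<times> ?Q. (case p of (x, J, J') \<Rightarrow> J \<union> J' \<union> {x}) = S}"
  have "B_op X r \<epsilon> t z K S = (\<Sum>(x, p) \<in> ?P S. K p) - A_op X \<epsilon> t K S" if "S \<in> \<S>" for S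
  proof -
    have "S \<subseteq> Z" using that S by auto
    then have "{(x, J, J'). x \<in> cball z r \<inter> X \<and>
          J \<in> indep_sets_upto X \<epsilon> t \<and> J' \<in> indep_sets_upto X \<epsilon> t \<and> J \<union> J' \<union> {x} = S} = ?P S"
      using Z \<open>Z \<subseteq> X\<close> by (auto simp: indep_sets_upto_def small_subsets_def
          intro: packing_independent_subset finite_subset)
    then show ?thesis unfolding B_op_def A_op_def by (simp add: case_prod_beta)
  qed
  then have "(\<Sum>S\<in>\<S>. B_op X r \<epsilon> t z K S)
      = (\<Sum>S\<in>\<S>. \<Sum>(x, p) \<in> ?P S. K p) - (\<Sum>S\<in>\<S>. A_op X \<epsilon> t K S)"
    by (simp add: sum_subtractf)
  also have "(\<Sum>S\<in>\<S>. \<Sum>(x, p) \<in> ?P S. K p) = (\<Sum>(x, p) \<in> ?C \<times> ?Q \<times> ?Q. K p)"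
    by (rule sum.group) (use fin Z un' in \<open>auto intro!: finite_cartesian_product finite_small_subsets\<close>)
  also have "\<dots> = real (card ?C) * pair_sum t K Z"
  proof -
    have "(\<Sum>(x, p) \<in> ?C \<times> ?Q \<times> ?Q. K p) = (\<Sum>x\<in>?C. \<Sum>p\<in>?Q \<times> ?Q. K p)"
      by (rule sum.cartesian_product[symmetric])
    then show ?thesis by (simp add: pair_sum_def sum.cartesian_product)
  qed
  also have "(\<Sum>S\<in>\<S>. A_op X \<epsilon> t K S) = pair_sum t K Z"
    by (rule sum_A_op[OF Z S un])
  finally show ?thesis by (simp add: algebra_simps)
qed

lemma A_op_eq_mobius:
  assumes "finite S" "packing_independent X \<epsilon> S"
  shows "A_op X \<epsilon> t K S = mobius (pair_sum t K) S"
  by (rule mobius_unique, fact, rule sum_A_op)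
    (use assms in \<open>auto simp: small_subsets_def intro: packing_independent_subset finite_subset\<close>)

lemma B_op_eq_mobius:
  assumes "finite S" "packing_independent X \<epsilon> S"
  shows "B_op X r \<epsilon> t z K S
       = mobius (\<lambda>R. (real (card (R \<inter> cball z r)) - 1) * pair_sum t K R) S"
  by (rule mobius_unique, fact, rule sum_B_op)
    (use assms in \<open>auto simp: small_subsets_def intro: packing_independent_subset finite_subset\<close>)

text \<open>Up to sign this is the Moebius transform of the constant \<open>1\<close>.\<close>

lemma sum_sign_Pow:
  assumes "finite D"
  shows "(\<Sum>J\<in>Pow D. (-1) ^ card J) = (of_bool (D = {}) :: real)"
proof -
  have "(\<Sum>J\<in>Pow D. (-1) ^ card J) = (-1) ^ card D * mobius (\<lambda>_. 1) D"
    by (simp add: mobius_def sum_distrib_left power_add flip: mult.assoc power_mult_distrib)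
  then show ?thesis using mobius_one[OF assms] by auto
qed

lemma sum_sign_card_Pow:
  assumes "finite D"
  shows "(\<Sum>J\<in>Pow D. (-1) ^ card J * real (card J)) = - of_bool (card D = 1)"
proof -
  have "(\<Sum>J\<in>Pow D. (-1) ^ card J * real (card J)) = (-1) ^ card D * mobius (\<lambda>R. real (card R)) D"
    by (simp add: mobius_def sum_distrib_left power_add flip: mult.assoc power_mult_distrib)
  then show ?thesis using mobius_card[OF assms] by (auto simp: of_bool_def)
qed

text \<open>The coefficient of a subset with \<open>j\<close> elements in a combination that vanishes on all sets \<open>D\<close> with
\<open>2 \<le> card D \<le> a\<close>. The alternating signs alone would produce the indicator of \<open>D = {}\<close>, at the price of
using subsets of size \<open>a\<close>; the factor \<open>1 - j / a\<close> removes these and adds only a value on singletons,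
where the weight \<open>card D - 1\<close> is zero anyway.\<close>

definition cut_coeff :: "nat \<Rightarrow> nat \<Rightarrow> real" where
  "cut_coeff a j = (-1) ^ j * (1 - real j / real a)"

lemma abs_cut_coeff_le: "j \<le> a \<Longrightarrow> \<bar>cut_coeff a j\<bar> \<le> 1"
  by (cases "a = 0") (auto simp: cut_coeff_def abs_mult power_abs)

text \<open>The product restricts the sum to subsets of \<open>R \<inter> C\<close>, and the bound \<open>a - 1\<close> on their size costs nothing
because \<open>cut_coeff a a = 0\<close>. What remains are the two alternating sums over \<open>Pow (R \<inter> C)\<close>.\<close>

lemma sum_cut_coeff:
  assumes R: "finite R" "card R \<le> a" and a: "1 \<le> a"
  shows "(\<Sum>J\<in>small_subsets (a - 1) R. cut_coeff a (card J) * (\<Prod>x\<in>J. of_bool (x \<in> C)))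
       = of_bool (R \<inter> C = {}) + of_bool (card (R \<inter> C) = 1) / real a"
proof -
  have fin: "finite (R \<inter> C)" using R by simp
  have pr: "(\<Prod>x\<in>J. of_bool (x \<in> C)) = (of_bool (J \<subseteq> C) :: real)" if "J \<subseteq> R" for J
    using finite_subset[OF that R(1)] by (auto simp: of_bool_def intro!: prod.neutral)
  have "(\<Sum>J\<in>small_subsets (a - 1) R. cut_coeff a (card J) * (\<Prod>x\<in>J. of_bool (x \<in> C)))
      = (\<Sum>J\<in>small_subsets (a - 1) R. cut_coeff a (card J) * of_bool (J \<subseteq> C))"
    by (rule sum.cong) (auto simp: pr small_subsets_def)
  also have "\<dots> = (\<Sum>J\<in>Pow (R \<inter> C). cut_coeff a (card J))"
  proof (rule sum.mono_neutral_cong)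
    fix J assume "J \<in> Pow (R \<inter> C) - small_subsets (a - 1) R"
    then have "card J \<le> a" "\<not> card J \<le> a - 1"
      using R card_mono[of R J] by (auto simp: small_subsets_def)
    then have "card J = a" by simp
    then show "cut_coeff a (card J) = 0" using a by (simp add: cut_coeff_def)
  qed (use R in \<open>auto simp: small_subsets_def\<close>)
  also have "\<dots> = (\<Sum>J\<in>Pow (R \<inter> C). (-1) ^ card J)
      - (\<Sum>J\<in>Pow (R \<inter> C). (-1) ^ card J * real (card J)) / real a"
    by (simp add: cut_coeff_def algebra_simps sum_subtractf sum_divide_distrib)
  finally show ?thesis
    by (simp only: sum_sign_Pow[OF fin] sum_sign_card_Pow[OF fin])
qed

section \<open>Radon measures: point masses and clopen restriction\<close>

lemma borel_sets_of_openin: "openin T U \<Longrightarrow> U \<in> borel_sets_of T"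
  by (auto simp: borel_sets_of_def)

lemma borel_sets_of_closedin:
  assumes "closedin T C"
  shows "C \<in> borel_sets_of T"
proof -
  have "topspace T - (topspace T - C) \<in> borel_sets_of T"
    unfolding borel_sets_of_def using assms
    by (intro sigma_sets.Compl sigma_sets.Basic) (auto simp: closedin_def)
  then show ?thesis using closedin_subset[OF assms] by (simp add: double_diff)
qed

lemma continuous_map_borel_measurable:
  assumes "M \<in> radon_measures T" "continuous_map T euclideanreal f"
  shows "f \<in> borel_measurable M"
proof (rule borel_measurableI)
  fix U :: "real set" assume "open U"
  then have "openin T {x \<in> topspace T. f x \<in> U}"
    using assms by (simp add: openin_continuous_map_preimage)
  moreover have "f -` U \<inter> space M = {x \<in> topspace T. f x \<in> U}"
    using assms by (auto simp: radon_measures_def)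
  ultimately show "f -` U \<inter> space M \<in> sets M"
    using assms by (auto simp: radon_measures_def borel_sets_of_openin)
qed

lemma continuous_map_bounded:
  assumes "compact_space T" "continuous_map T euclideanreal f"
  obtains B where "\<And>x. x \<in> topspace T \<Longrightarrow> \<bar>f x\<bar> \<le> B"
proof -
  have "compactin euclideanreal (f ` topspace T)"
    using assms by (metis compact_space_def image_compactin)
  then have "bounded (f ` topspace T)"
    by (simp add: compact_imp_bounded)
  then show ?thesis using that by (auto simp: bounded_iff)
qed

lemma continuous_map_integrable:
  assumes "compact_space T" "M \<in> radon_measures T" "continuous_map T euclideanreal f"
  shows "integrable M f"
proof -
  obtain B where B: "\<And>x. x \<in> topspace T \<Longrightarrow> \<bar>f x\<bar> \<le> B"
    using continuous_map_bounded[OF assms(1,3)] by blast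
  interpret finite_measure M using assms(2) by (simp add: radon_measures_def)
  show ?thesis
    by (rule integrable_const_bound[of _ B])
      (use B assms continuous_map_borel_measurable in \<open>auto simp: radon_measures_def\<close>)
qed

text \<open>Transposition is a homeomorphism of the square.\<close>

lemma borel_sets_of_swap:
  assumes "E \<in> borel_sets_of (prod_topology T T)"
  shows "prod.swap ` E \<in> borel_sets_of (prod_topology T T)"
proof -
  let ?P = "prod_topology T T"
  have sw: "prod.swap ` topspace ?P = topspace ?P" by auto
  have "prod.swap ` E \<in> sigma_sets (topspace ?P) {U. openin ?P U}"
    if "E \<in> sigma_sets (topspace ?P) {U. openin ?P U}" for E
    using that
  proof induction
    case (Basic U)
    then have U: "openin ?P U" by simp
    have "continuous_map ?P ?P (\<lambda>p. (snd p, fst p))"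
      by (intro continuous_map_pairedI continuous_map_fst continuous_map_snd)
    then have "openin ?P {p \<in> topspace ?P. (snd p, fst p) \<in> U}"
      by (rule openin_continuous_map_preimage[OF _ U])
    moreover have "{p \<in> topspace ?P. (snd p, fst p) \<in> U} = prod.swap ` U"
      using openin_subset[OF U] by force
    ultimately show ?case by (auto intro: sigma_sets.Basic)
  next
    case (Compl A)
    have "prod.swap ` (topspace ?P - A) = topspace ?P - prod.swap ` A"
      by (subst image_set_diff[OF inj_swap]) (simp only: sw)
    then show ?case using sigma_sets.Compl[OF Compl.IH] by simp
  next
    case (Union A)
    then show ?case by (simp add: image_UN sigma_sets.Union)
  qed (simp add: sigma_sets.Empty)
  then show ?thesis using assms by (simp add: borel_sets_of_def)
qed

text \<open>The measure is transported from the power set of \<open>F\<close> to the Borel sets, so that integrals become finite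
sums.\<close>

definition point_masses :: "'b topology \<Rightarrow> 'b set \<Rightarrow> ('b \<Rightarrow> real) \<Rightarrow> 'b measure" where
  "point_masses T F w = distr (point_measure F (\<lambda>x. ennreal (w x)))
     (sigma (topspace T) {U. openin T U}) id"

context
  fixes T :: "'b topology" and F :: "'b set" and w :: "'b \<Rightarrow> real"
  assumes fin: "finite F" and closed: "\<And>x. x \<in> F \<Longrightarrow> closedin T {x}"
    and nonneg: "\<And>x. x \<in> F \<Longrightarrow> 0 \<le> w x"
begin

lemma F_subset: "F \<subseteq> topspace T"
  using closed closedin_subset by fastforce

lemma space_point_masses: "space (point_masses T F w) = topspace T"
  by (simp add: point_masses_def space_measure_of_conv)

lemma sets_point_masses: "sets (point_masses T F w) = borel_sets_of T"
  by (auto simp: point_masses_def borel_sets_of_def sets_measure_of_conv dest: openin_subset)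

lemma id_measurable: "id \<in> measurable (point_measure F (\<lambda>x. ennreal (w x))) (sigma (topspace T) {U. openin T U})"
  using F_subset by (auto simp: measurable_def space_point_measure sets_point_measure space_measure_of_conv)

lemma emeasure_point_masses:
  assumes "E \<in> borel_sets_of T"
  shows "emeasure (point_masses T F w) E = ennreal (\<Sum>x\<in>F \<inter> E. w x)"
proof -
  have "E \<in> sets (sigma (topspace T) {U. openin T U})"
    using assms sets_point_masses by (simp add: point_masses_def)
  then have "emeasure (point_masses T F w) E = emeasure (point_measure F (\<lambda>x. ennreal (w x))) (F \<inter> E)"
    unfolding point_masses_def
    by (subst emeasure_distr[OF id_measurable]) (auto simp: space_point_measure Int_commute)
  also have "\<dots> = (\<Sum>x\<in>F \<inter> E. ennreal (w x))"
    by (rule emeasure_point_measure_finite) (use fin in auto)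
  also have "\<dots> = ennreal (\<Sum>x\<in>F \<inter> E. w x)"
    by (rule sum_ennreal) (use nonneg in auto)
  finally show ?thesis .
qed

lemma measure_point_masses:
  assumes "E \<in> borel_sets_of T"
  shows "measure (point_masses T F w) E = (\<Sum>x\<in>F \<inter> E. w x)"
  using emeasure_point_masses[OF assms] nonneg
  by (simp add: measure_def) (rule enn2real_ennreal, rule sum_nonneg, auto)

text \<open>Inner regularity holds with the finite, hence compact, set \<open>F \<inter> E\<close>, which is Borel because its points
are closed.\<close>

lemma point_masses_radon: "point_masses T F w \<in> radon_measures T"
  unfolding radon_measures_def mem_Collect_eq sets_point_masses
proof (intro conjI ballI space_point_masses refl)
  have "topspace T \<in> borel_sets_of T" by (rule borel_sets_of_openin) simp
  then show "finite_measure (point_masses T F w)"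
    by (intro finite_measureI) (simp add: space_point_masses emeasure_point_masses)
  fix E assume E: "E \<in> borel_sets_of T"
  have cl: "closedin T (F \<inter> E)"
  proof -
    have "F \<inter> E = \<Union>((\<lambda>x. {x}) ` (F \<inter> E))" by auto
    moreover have "closedin T (\<Union>((\<lambda>x. {x}) ` (F \<inter> E)))"
      by (rule closedin_Union) (use fin closed in auto)
    ultimately show ?thesis by simp
  qed
  have co: "compactin T (F \<inter> E)"
    by (rule finite_imp_compactin) (use fin F_subset in auto)
  have eq: "emeasure (point_masses T F w) E = emeasure (point_masses T F w) (F \<inter> E)"
    using E borel_sets_of_closedin[OF cl] by (simp add: emeasure_point_masses)
  show "emeasure (point_masses T F w) E
      = (SUP C\<in>{C. compactin T C \<and> C \<subseteq> E}. emeasure (point_masses T F w) C)"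
  proof (rule antisym)
    show "emeasure (point_masses T F w) E \<le> (SUP C\<in>{C. compactin T C \<and> C \<subseteq> E}. emeasure (point_masses T F w) C)"
      unfolding eq by (rule SUP_upper) (use co in auto)
    show "(SUP C\<in>{C. compactin T C \<and> C \<subseteq> E}. emeasure (point_masses T F w) C) \<le> emeasure (point_masses T F w) E"
      by (rule SUP_least) (use E in \<open>auto intro!: emeasure_mono simp: sets_point_masses\<close>)
  qed
qed

lemma integral_point_masses:
  fixes f :: "'b \<Rightarrow> real"
  assumes "f \<in> borel_measurable (point_masses T F w)"
  shows "integral\<^sup>L (point_masses T F w) f = (\<Sum>x\<in>F. w x * f x)"
proof -
  have f: "f \<in> borel_measurable (sigma (topspace T) {U. openin T U})"
    using assms by (simp add: point_masses_def)
  show ?thesis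
    unfolding point_masses_def using integral_distr[OF id_measurable f]
    by (simp add: lebesgue_integral_point_measure_finite fin nonneg)
qed

end

lemma point_masses_empty_radon: "point_masses T {} w \<in> radon_measures T"
  by (rule point_masses_radon) auto

lemma signed_integral_point_masses:
  assumes T: "compact_space T" and f: "continuous_map T euclideanreal f"
    and F: "finite F" "\<And>x. x \<in> F \<Longrightarrow> closedin T {x}" "\<And>x. x \<in> F \<Longrightarrow> 0 \<le> w x"
  shows "signed_integral T f (measure (point_masses T F w)) = (\<Sum>x\<in>F. w x * f x)"
proof -
  let ?M = "point_masses T F w" and ?N = "point_masses T {} w"
  have M: "?M \<in> radon_measures T" by (rule point_masses_radon) (use F in auto)
  have N: "measure ?N E = 0" for E
  proof (cases "E \<in> borel_sets_of T")
    case True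
    then show ?thesis by (subst measure_point_masses) auto
  next
    case False
    then have "E \<notin> sets (point_masses T {} w)" by (subst sets_point_masses) auto
    then show ?thesis by (rule measure_notin_sets)
  qed
  have "signed_integral T f (\<lambda>E. measure ?M E - measure ?N E) = integral\<^sup>L ?M f - integral\<^sup>L ?N f"
    by (rule signed_integral_eq[OF T f M point_masses_empty_radon])
  also have "integral\<^sup>L ?M f = (\<Sum>x\<in>F. w x * f x)"
    by (rule integral_point_masses[OF F continuous_map_borel_measurable[OF M f]])
  also have "integral\<^sup>L ?N f = (\<Sum>x\<in>{}. w x * f x)"
    by (rule integral_point_masses[OF _ _ _ continuous_map_borel_measurable[OF point_masses_empty_radon f]]) auto
  finally show ?thesis by (simp add: N)
qed

lemma measure_point_masses_signed:
  assumes F: "finite F" "\<And>x. x \<in> F \<Longrightarrow> closedin T {x}" "\<And>x. x \<in> F \<Longrightarrow> 0 \<le> w x"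
  shows "measure (point_masses T F w) \<in> signed_radon_measures T"
proof -
  have N: "measure (point_masses T {} w) E = 0" for E
  proof (cases "E \<in> borel_sets_of T")
    case True
    then show ?thesis by (subst measure_point_masses) auto
  next
    case False
    then have "E \<notin> sets (point_masses T {} w)" by (subst sets_point_masses) auto
    then show ?thesis by (rule measure_notin_sets)
  qed
  have "measure (point_masses T F w)
      = (\<lambda>E. measure (point_masses T F w) E - measure (point_masses T {} w) E)"
    by (simp add: N)
  moreover have "point_masses T F w \<in> radon_measures T"
    by (rule point_masses_radon) (use F in auto)
  ultimately show ?thesis
    unfolding signed_radon_measures_def using point_masses_empty_radon by blast
qed

lemma borel_sets_of_subtopology:
  assumes "openin T Y"
  shows "borel_sets_of (subtopology T Y) = (\<inter>) Y ` borel_sets_of T"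
proof -
  have "{U. openin (subtopology T Y) U} = (\<inter>) Y ` {U. openin T U}"
    by (auto simp: openin_subtopology)
  then show ?thesis
    unfolding borel_sets_of_def topspace_subtopology_subset[OF openin_subset[OF assms]]
    using sigma_sets_Int[of Y "topspace T" "{U. openin T U}"] assms openin_subset[OF assms]
    by (simp add: sigma_sets.Basic)
qed

text \<open>The compact subsets of \<open>E \<subseteq> Y\<close> are the same in \<open>Y\<close> and in the whole space.\<close>

lemma restrict_space_radon:
  assumes M: "M \<in> radon_measures T" and Y: "openin T Y"
  shows "restrict_space M Y \<in> radon_measures (subtopology T Y)"
proof -
  have YT: "Y \<subseteq> topspace T" using Y by (rule openin_subset)
  have sp: "space M = topspace T" and se: "sets M = borel_sets_of T" and fm: "finite_measure M"
    and reg: "\<And>E. E \<in> sets M \<Longrightarrow> emeasure M E = (SUP C\<in>{C. compactin T C \<and> C \<subseteq> E}. emeasure M C)"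
    using M by (auto simp: radon_measures_def)
  have YM: "Y \<inter> space M \<in> sets M" "Y \<inter> space M = Y"
    using Y YT borel_sets_of_openin by (auto simp: sp se Int_absorb2)
  have sets: "sets (restrict_space M Y) = borel_sets_of (subtopology T Y)"
    by (simp add: sets_restrict_space se borel_sets_of_subtopology[OF Y])
  have em: "emeasure (restrict_space M Y) A = emeasure M A" if "A \<subseteq> Y" for A
    using that YM by (simp add: emeasure_restrict_space)
  have "emeasure (restrict_space M Y) E
      = (SUP C\<in>{C. compactin (subtopology T Y) C \<and> C \<subseteq> E}. emeasure (restrict_space M Y) C)"
    if "E \<in> sets (restrict_space M Y)" for E
  proof -
    have E: "E \<subseteq> Y" "E \<in> sets M"
      using that YM by (auto simp: sets_restrict_space)
    have "{C. compactin (subtopology T Y) C \<and> C \<subseteq> E} = {C. compactin T C \<and> C \<subseteq> E}"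
      using E by (auto simp: compactin_subtopology)
    then have "(SUP C\<in>{C. compactin (subtopology T Y) C \<and> C \<subseteq> E}. emeasure (restrict_space M Y) C)
        = (SUP C\<in>{C. compactin T C \<and> C \<subseteq> E}. emeasure M C)"
      by (intro SUP_cong) (use E em in auto)
    then show ?thesis using E reg[of E] em[of E] by simp
  qed
  moreover have "finite_measure (restrict_space M Y)"
    using fm YM by (intro finite_measureI)
      (auto simp: space_restrict_space em finite_measure.emeasure_finite)
  ultimately show ?thesis
    by (simp add: radon_measures_def sets space_restrict_space sp YT Int_absorb1 Int_absorb2)
qed

lemma continuous_map_extend_zero:
  assumes Y: "openin T Y" "closedin T Y" and f: "continuous_map (subtopology T Y) euclideanreal f"
  shows "continuous_map T euclideanreal (\<lambda>x. indicator Y x * f x)"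
  unfolding continuous_map_def
proof (intro conjI allI impI)
  fix U :: "real set" assume "openin euclidean U"
  then have "openin (subtopology T Y) {x \<in> topspace (subtopology T Y). f x \<in> U}"
    using f by (rule openin_continuous_map_preimage[rotated])
  then have 1: "openin T {x \<in> topspace (subtopology T Y). f x \<in> U}"
    using Y(1) openin_trans_full by blast
  have 2: "openin T (if 0 \<in> U then topspace T - Y else {})"
    using Y(2) by (simp add: openin_diff)
  have "{x \<in> topspace T. indicator Y x * f x \<in> U}
     = {x \<in> topspace (subtopology T Y). f x \<in> U} \<union> (if 0 \<in> U then topspace T - Y else {})"
    by (auto simp: indicator_def split: if_splits)
  then show "openin T {x \<in> topspace T. indicator Y x * f x \<in> U}"
    using openin_Un[OF 1 2] by simp
qed auto

lemma psd_kernel_nonneg: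
  fixes m :: nat and J :: "nat \<Rightarrow> 'b" and c :: "nat \<Rightarrow> real"
  assumes K: "K \<in> psd_kernels T" and J: "\<forall>i<m. J i \<in> topspace T"
  shows "0 \<le> (\<Sum>i<m. \<Sum>j<m. c i * c j * K (J i, J j))"
proof -
  have "\<forall>m. \<forall>J::nat \<Rightarrow> _. (\<forall>i<m. J i \<in> topspace T) \<longrightarrow>
     (\<forall>c::nat \<Rightarrow> real. 0 \<le> (\<Sum>i<m. \<Sum>j<m. c i * c j * K (J i, J j)))"
    using K unfolding psd_kernels_def mem_Collect_eq by (rule conjunct2)
  from this[THEN spec, THEN spec, THEN mp, OF J] show ?thesis ..
qed

text \<open>The quadratic form of a rank one kernel is a square.\<close>

lemma rank_one_psd_kernel:
  assumes "continuous_map T euclideanreal f"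
  shows "(\<lambda>(J, J'). f J * f J') \<in> psd_kernels T"
proof -
  have "continuous_map (prod_topology T T) euclideanreal (\<lambda>p. f (fst p) * f (snd p))"
    by (intro continuous_map_real_mult continuous_map_compose[OF continuous_map_fst assms, unfolded o_def]
        continuous_map_compose[OF continuous_map_snd assms, unfolded o_def])
  moreover have "(\<Sum>i<m. \<Sum>j<m. c i * c j * (f (J i) * f (J j))) = (\<Sum>i<m. c i * f (J i))\<^sup>2"
    for m :: nat and J c
    by (simp add: power2_eq_square sum_product algebra_simps)
  ultimately show ?thesis
    by (simp add: psd_kernels_def sym_kernels_def case_prod_unfold mult.commute)
qed

lemma sym_kernel_extend_zero:
  assumes Y: "openin T Y" "closedin T Y" and K: "K \<in> sym_kernels (subtopology T Y)"
  shows "(\<lambda>p. indicator (Y \<times> Y) p * K p) \<in> sym_kernels T"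
proof -
  have "subtopology (prod_topology T T) (Y \<times> Y) = prod_topology (subtopology T Y) (subtopology T Y)"
    by (simp add: subtopology_Times)
  then have "continuous_map (prod_topology T T) euclideanreal (\<lambda>p. indicator (Y \<times> Y) p * K p)"
    using K Y by (intro continuous_map_extend_zero)
      (auto simp: sym_kernels_def openin_prod_Times_iff closedin_prod_Times_iff)
  then show ?thesis
    using K openin_subset[OF Y(1)] by (auto simp: sym_kernels_def indicator_def)
qed

text \<open>Points outside \<open>Y\<close> contribute zero to the quadratic form; replacing them by a fixed \<open>y \<in> Y\<close> with
coefficient zero turns the form into one of the given kernel.\<close>

lemma psd_kernel_extend_zero:
  assumes Y: "openin T Y" "closedin T Y" and K: "K \<in> psd_kernels (subtopology T Y)"
  shows "(\<lambda>p. indicator (Y \<times> Y) p * K p) \<in> psd_kernels T"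
proof -
  have s: "(\<lambda>p. indicator (Y \<times> Y) p * K p) \<in> sym_kernels T"
    using K by (intro sym_kernel_extend_zero[OF Y]) (simp add: psd_kernels_def)
  have "0 \<le> (\<Sum>i<m. \<Sum>j<m. c i * c j * (indicator (Y \<times> Y) (J i, J j) * K (J i, J j)))"
    for m :: nat and J and c :: "nat \<Rightarrow> real"
  proof (cases "\<exists>y. y \<in> Y")
    case False
    then show ?thesis by simp
  next
    case True
    then obtain y where y: "y \<in> Y" by blast
    \<comment> \<open>The substitute \<open>y\<close> always gets coefficient zero.\<close>
    define J' where "J' i = (if J i \<in> Y then J i else y)" for i
    define c' where "c' i = (if J i \<in> Y then c i else 0)" for i
    have "0 \<le> (\<Sum>i<m. \<Sum>j<m. c' i * c' j * K (J' i, J' j))"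
    proof -
      have "\<forall>i<m. J' i \<in> topspace (subtopology T Y)"
        using y openin_subset[OF Y(1)] by (auto simp: J'_def)
      then show ?thesis using K unfolding psd_kernels_def by blast
    qed
    also have "\<dots> = (\<Sum>i<m. \<Sum>j<m. c i * c j * (indicator (Y \<times> Y) (J i, J j) * K (J i, J j)))"
      by (intro sum.cong refl) (auto simp: c'_def J'_def indicator_def)
    finally show ?thesis .
  qed
  then show ?thesis using s by (simp add: psd_kernels_def)
qed

text \<open>Restricting a measure is dual to extending kernels by zero, which is continuous because \<open>Y\<close> is clopen
and preserves positive definiteness.\<close>

lemma psd_measure_restrict:
  assumes T: "compact_space T" and Y: "openin T Y" "closedin T Y"
    and \<nu>: "\<nu> \<in> psd_measures T"
  obtains \<nu>' where "\<nu>' \<in> psd_measures (subtopology T Y)"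
    and "\<And>K. K \<in> sym_kernels (subtopology T Y) \<Longrightarrow>
      signed_integral (prod_topology (subtopology T Y) (subtopology T Y)) K \<nu>'
      = signed_integral (prod_topology T T) (\<lambda>p. indicator (Y \<times> Y) p * K p) \<nu>"
proof -
  let ?P = "prod_topology T T" and ?Y = "Y \<times> Y"
  let ?Q = "prod_topology (subtopology T Y) (subtopology T Y)"
  have Q: "?Q = subtopology ?P ?Y" by (simp add: subtopology_Times)
  have YY: "openin ?P ?Y" "closedin ?P ?Y"
    using Y by (auto simp: openin_prod_Times_iff closedin_prod_Times_iff)
  have cP: "compact_space ?P" using T by (simp add: compact_space_prod_topology)
  have cQ: "compact_space ?Q"
    using T Y by (simp add: compact_space_prod_topology closedin_compact_space compact_space_subtopology)
  from \<nu> obtain M N where M: "M \<in> radon_measures ?P" and N: "N \<in> radon_measures ?P"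
    and \<nu>_eq: "\<nu> = (\<lambda>E. measure M E - measure N E)"
    by (auto simp: psd_measures_def sym_radon_measures_def signed_radon_measures_def)
  let ?M = "restrict_space M ?Y" and ?N = "restrict_space N ?Y"
  have M': "?M \<in> radon_measures ?Q" and N': "?N \<in> radon_measures ?Q"
    unfolding Q using M N YY by (auto intro: restrict_space_radon)
  define \<nu>' where "\<nu>' = (\<lambda>E. measure ?M E - measure ?N E)"
  have meas: "?Y \<inter> space L \<in> sets L" if "L \<in> radon_measures ?P" for L
    using that YY(1) borel_sets_of_openin openin_subset[OF YY(1)]
    by (auto simp: radon_measures_def Int_absorb2)
  have int: "integral\<^sup>L (restrict_space L ?Y) K = integral\<^sup>L L (\<lambda>p. indicator ?Y p * K p)"
    if "L \<in> radon_measures ?P" for L and K :: "'a \<times> 'a \<Rightarrow> real"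
    using integral_restrict_space[OF meas[OF that], of K] by simp
  have eq: "signed_integral ?Q K \<nu>' = signed_integral ?P (\<lambda>p. indicator ?Y p * K p) \<nu>"
    if K: "K \<in> sym_kernels (subtopology T Y)" for K
  proof -
    have "continuous_map ?P euclideanreal (\<lambda>p. indicator ?Y p * K p)"
      using sym_kernel_extend_zero[OF Y K] by (simp add: sym_kernels_def)
    then have "signed_integral ?P (\<lambda>p. indicator ?Y p * K p) \<nu>
        = integral\<^sup>L M (\<lambda>p. indicator ?Y p * K p) - integral\<^sup>L N (\<lambda>p. indicator ?Y p * K p)"
      unfolding \<nu>_eq by (rule signed_integral_eq[OF cP _ M N])
    moreover have "continuous_map ?Q euclideanreal K"
      using K by (simp add: sym_kernels_def)
    then have "signed_integral ?Q K \<nu>' = integral\<^sup>L ?M K - integral\<^sup>L ?N K"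
      unfolding \<nu>'_def by (rule signed_integral_eq[OF cQ _ M' N'])
    ultimately show ?thesis using int[OF M] int[OF N] by simp
  qed
  have "\<nu>' (prod.swap ` E) = \<nu>' E" if E: "E \<in> borel_sets_of ?Q" for E
  proof -
    have "E \<in> (\<inter>) ?Y ` borel_sets_of ?P"
      using E unfolding Q borel_sets_of_subtopology[OF YY(1)] .
    then obtain E0 where E0: "E0 \<in> borel_sets_of ?P" "E = ?Y \<inter> E0" by blast
    have EP: "E \<in> borel_sets_of ?P"
    proof -
      have "?Y \<in> sets M" "E0 \<in> sets M"
        using M E0 borel_sets_of_openin[OF YY(1)] by (auto simp: radon_measures_def)
      then have "E \<in> sets M" unfolding E0(2) by (rule sets.Int)
      then show ?thesis using M by (simp add: radon_measures_def)
    qed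
    have sub: "E \<subseteq> ?Y" "prod.swap ` E \<subseteq> ?Y" using E0 by auto
    have r: "\<nu>' A = \<nu> A" if "A \<subseteq> ?Y" for A
      using that meas M N by (simp add: \<nu>'_def \<nu>_eq measure_restrict_space)
    show ?thesis
      using \<nu> EP r[OF sub(1)] r[OF sub(2)]
      by (simp add: psd_measures_def sym_radon_measures_def)
  qed
  then have "\<nu>' \<in> sym_radon_measures (subtopology T Y)"
    using M' N' by (auto simp: sym_radon_measures_def signed_radon_measures_def \<nu>'_def)
  moreover have "0 \<le> signed_integral ?Q K \<nu>'" if "K \<in> psd_kernels (subtopology T Y)" for K
    using that eq[of K] psd_kernel_extend_zero[OF Y that] \<nu>
    by (simp add: psd_kernels_def psd_measures_def)
  ultimately have "\<nu>' \<in> psd_measures (subtopology T Y)"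
    by (simp add: psd_measures_def)
  then show ?thesis using that eq by blast
qed

section \<open>The topology of the spaces of independent sets\<close>

lemma hausdorff_dist_less_iff:
  fixes S T :: "'a::metric_space set"
  assumes "finite S" "S \<noteq> {}" "finite T" "T \<noteq> {}"
  shows "hausdorff_dist S T < \<delta> \<longleftrightarrow>
    (\<forall>x\<in>S. \<exists>y\<in>T. dist x y < \<delta>) \<and> (\<forall>y\<in>T. \<exists>x\<in>S. dist x y < \<delta>)"
proof -
  have *: "(SUP x\<in>A. infdist x B) < \<delta> \<longleftrightarrow> (\<forall>x\<in>A. \<exists>y\<in>B. dist x y < \<delta>)"
    if "finite A" "A \<noteq> {}" "finite B" "B \<noteq> {}" for A B :: "'a set"
  proof -
    have "infdist x B < \<delta> \<longleftrightarrow> (\<exists>y\<in>B. dist x y < \<delta>)" for x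
      using that by (simp add: infdist_notempty cINF_less_iff)
    then show ?thesis
      using that by (subst finite_Sup_less_iff) auto
  qed
  show ?thesis
    unfolding hausdorff_dist_def using *[of S T] *[of T S] assms by (simp add: dist_commute)
qed

lemma sum_Pow_image:
  assumes "inj_on b S"
  shows "(\<Sum>R\<in>Pow (b ` S). \<phi> R) = (\<Sum>R\<in>Pow S. \<phi> (b ` R))"
  using sum.reindex[OF inj_on_image_Pow[OF assms], of \<phi>] by (simp add: image_Pow_surj)

lemma small_subsets_image:
  assumes "inj_on b S"
  shows "small_subsets t (b ` S) = (`) b ` small_subsets t S"
proof -
  have c: "card (b ` J) = card J" if "J \<subseteq> S" for J
    using assms that by (meson card_image inj_on_subset)
  show ?thesis
  proof
    show "small_subsets t (b ` S) \<subseteq> (`) b ` small_subsets t S"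
    proof
      fix R assume R: "R \<in> small_subsets t (b ` S)"
      then obtain J where J: "J \<subseteq> S" "R = b ` J"
        by (auto simp: small_subsets_def subset_image_iff)
      with R c have "J \<in> small_subsets t S" by (simp add: small_subsets_def)
      with J show "R \<in> (`) b ` small_subsets t S" by blast
    qed
  qed (auto simp: small_subsets_def c)
qed

lemma sum_small_subsets_image:
  assumes "inj_on b S"
  shows "(\<Sum>R\<in>small_subsets t (b ` S). \<phi> R) = (\<Sum>R\<in>small_subsets t S. \<phi> (b ` R))"
proof -
  have "inj_on ((`) b) (small_subsets t S)"
    by (rule inj_on_subset[OF inj_on_image_Pow[OF assms]]) (auto simp: small_subsets_def)
  from sum.reindex[OF this, of \<phi>] show ?thesis
    by (simp add: small_subsets_image[OF assms])
qed

locale compact_packing =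
  fixes X :: "'a::metric_space set" and \<epsilon> :: real
  assumes compact_X: "compact X" and eps_pos: "\<epsilon> > 0"
begin

abbreviation "I \<equiv> indep_sets_upto X \<epsilon>"
abbreviation "T \<equiv> indep_topology X \<epsilon>"

lemmas topspace_T = topspace_indep_topology[of X \<epsilon>]

lemma indep_dist:
  assumes "packing_independent X \<epsilon> S" "x \<in> S" "y \<in> S" "x \<noteq> y"
  shows "\<epsilon> \<le> dist x y"
proof (rule ccontr)
  assume "\<not> \<epsilon> \<le> dist x y"
  then have "x \<in> (ball x \<epsilon> \<inter> X) \<inter> (ball y \<epsilon> \<inter> X)"
    using assms eps_pos by (auto simp: packing_independent_def dist_commute)
  then show False
    using assms unfolding packing_independent_def packing_adjacent_def by blast
qed

lemma I_subset: "S \<in> I n \<Longrightarrow> R \<subseteq> S \<Longrightarrow> card R \<le> m \<Longrightarrow> R \<in> I m"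
  by (auto simp: indep_sets_upto_def intro: packing_independent_subset finite_subset)

lemma I_subset_same: "S \<in> I n \<Longrightarrow> R \<subseteq> S \<Longrightarrow> R \<in> I n"
  by (rule I_subset) (auto simp: indep_sets_upto_def intro: order_trans[OF card_mono])

lemma I_finite: "S \<in> I n \<Longrightarrow> finite S"
  by (simp add: indep_sets_upto_def)

lemma I_mono: "s \<le> t \<Longrightarrow> I s \<subseteq> I t"
  by (auto simp: indep_sets_upto_def)

lemma empty_in_I: "{} \<in> I n"
  by (simp add: indep_sets_upto_def packing_independent_def)

text \<open>The bijections that move each point of \<open>S\<close> only slightly and keep it in the space, as a filter. Since
distinct points of an independent set are at least \<open>\<epsilon>\<close> apart, Hausdorff-close independent sets are
images of each other under such maps (\<open>hausdorff_close_transport\<close>). Subsets of \<open>S\<close> move along with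
\<open>S\<close>, so continuity of sums over subsets reduces to termwise limits along this filter.\<close>

definition near :: "nat \<Rightarrow> 'a set \<Rightarrow> ('a \<Rightarrow> 'a) filter" where
  "near n S = (INF \<delta>\<in>{0<..}. principal {b. inj_on b S \<and> b ` S \<in> I n \<and> (\<forall>s\<in>S. dist s (b s) < \<delta>)})"

lemma eventually_near:
  "eventually P (near n S) \<longleftrightarrow>
     (\<exists>\<delta>>0. \<forall>b. inj_on b S \<longrightarrow> b ` S \<in> I n \<longrightarrow> (\<forall>s\<in>S. dist s (b s) < \<delta>) \<longrightarrow> P b)"
  unfolding near_def
proof (subst eventually_INF_base)
  fix d e :: real assume "d \<in> {0<..}" "e \<in> {0<..}"
  then show "\<exists>x\<in>{0<..}. principal {b. inj_on b S \<and> b ` S \<in> I n \<and> (\<forall>s\<in>S. dist s (b s) < x)}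
      \<le> inf (principal {b. inj_on b S \<and> b ` S \<in> I n \<and> (\<forall>s\<in>S. dist s (b s) < d)})
            (principal {b. inj_on b S \<and> b ` S \<in> I n \<and> (\<forall>s\<in>S. dist s (b s) < e)})"
    by (intro bexI[of _ "min d e"]) auto
qed (auto simp: eventually_principal intro: exI[of _ 1])

lemma eventually_near_inj: "eventually (\<lambda>b. inj_on b S \<and> b ` S \<in> I n) (near n S)"
  unfolding eventually_near by (intro exI[of _ 1]) auto

text \<open>Moving \<open>S\<close> slightly moves each subset \<open>R\<close> slightly, also when \<open>R\<close> is regarded as a point of a space
\<open>I m\<close> with a different size bound.\<close>

lemma near_mono:
  assumes "S \<in> I n" "R \<subseteq> S" "card R \<le> m"
  shows "near n S \<le> near m R"
proof (rule filter_leI)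
  fix P assume "eventually P (near m R)"
  then obtain \<delta> where \<delta>: "\<delta> > 0" and
    P: "\<And>b. inj_on b R \<Longrightarrow> b ` R \<in> I m \<Longrightarrow> (\<forall>s\<in>R. dist s (b s) < \<delta>) \<Longrightarrow> P b"
    unfolding eventually_near by blast
  have "finite R" using assms I_finite finite_subset by blast
  have "P b" if "inj_on b S" "b ` S \<in> I n" "\<forall>s\<in>S. dist s (b s) < \<delta>" for b
  proof (rule P)
    show "inj_on b R" using that assms by (meson inj_on_subset)
    show "b ` R \<in> I m"
      using that assms \<open>finite R\<close> by (intro I_subset[OF that(2)]) (auto intro: order_trans[OF card_image_le])
  qed (use that assms in auto)
  then show "eventually P (near n S)"
    unfolding eventually_near using \<delta> by blast
qed

lemma tendsto_near_point:
  assumes "x \<in> S"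
  shows "((\<lambda>b. b x) \<longlongrightarrow> x) (near n S)"
proof (rule tendstoI)
  fix e :: real assume "e > 0"
  then show "\<forall>\<^sub>F b in near n S. dist (b x) x < e"
    unfolding eventually_near using assms by (intro exI[of _ e]) (auto simp: dist_commute)
qed

lemma indep_openD:
  assumes "indep_open X \<epsilon> n U" "S \<in> U" "S \<noteq> {}"
  shows "\<exists>\<delta>>0. \<forall>S'\<in>I n. S' \<noteq> {} \<and> hausdorff_dist S S' < \<delta> \<longrightarrow> S' \<in> U"
  using assms unfolding indep_open_def by (metis (lifting))

text \<open>A nonempty \<open>S\<close> moves by less than \<open>\<delta>\<close> in the Hausdorff distance when its points do; the empty set,
which is isolated, is its own image.\<close>

lemma limitin_near:
  assumes S: "S \<in> I n"
  shows "limitin (T n) (\<lambda>b. b ` S) S (near n S)"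
  unfolding limitin_def topspace_T
proof (intro conjI allI impI S)
  fix U assume U: "openin (T n) U \<and> S \<in> U"
  show "\<forall>\<^sub>F b in near n S. b ` S \<in> U"
  proof (cases "S = {}")
    case False
    obtain \<delta> where \<delta>: "\<delta> > 0"
      "\<And>S'. S' \<in> I n \<Longrightarrow> S' \<noteq> {} \<Longrightarrow> hausdorff_dist S S' < \<delta> \<Longrightarrow> S' \<in> U"
    proof -
      have "indep_open X \<epsilon> n U" "S \<in> U" using U by (auto simp: openin_indep_topology)
      then have "\<exists>\<delta>>0. \<forall>S'\<in>I n. S' \<noteq> {} \<and> hausdorff_dist S S' < \<delta> \<longrightarrow> S' \<in> U"
        using False by (rule indep_openD)
      then show thesis using that by blast
    qed
    have "b ` S \<in> U" if "b ` S \<in> I n" "\<forall>s\<in>S. dist s (b s) < \<delta>" for b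
    proof (rule \<delta>(2))
      show "hausdorff_dist S (b ` S) < \<delta>"
        using False that I_finite[OF S] by (subst hausdorff_dist_less_iff) auto
    qed (use that False in auto)
    then show ?thesis
      unfolding eventually_near using \<delta> by blast
  qed (use U in auto)
qed

text \<open>A point of \<open>S\<close> has a point of \<open>S'\<close> within \<open>\<delta>\<close>. Two points of \<open>S\<close> with the same partner, or two points of
\<open>S'\<close> near the same point, would be closer than \<open>2 * \<delta> \<le> \<epsilon>\<close>, which independence excludes.\<close>

lemma hausdorff_close_transport:
  assumes S: "S \<in> I m" "S \<noteq> {}" and S': "S' \<in> I n" "S' \<noteq> {}"
    and hd: "hausdorff_dist S S' < \<delta>" and \<delta>: "\<delta> \<le> \<epsilon> / 2"
  shows "\<exists>b. inj_on b S \<and> b ` S = S' \<and> (\<forall>s\<in>S. dist s (b s) < \<delta>)"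
proof -
  have fin: "finite S" "finite S'" using S S' I_finite by auto
  have ind: "packing_independent X \<epsilon> S" "packing_independent X \<epsilon> S'"
    using S S' by (auto simp: indep_sets_upto_def)
  have 1: "\<forall>x\<in>S. \<exists>y\<in>S'. dist x y < \<delta>" and 2: "\<forall>y\<in>S'. \<exists>x\<in>S. dist x y < \<delta>"
    using hd S S' fin by (auto simp: hausdorff_dist_less_iff)
  obtain b where b: "\<forall>x\<in>S. b x \<in> S' \<and> dist x (b x) < \<delta>" using 1 by metis
  have "inj_on b S"
  proof (rule inj_onI, rule ccontr)
    fix x y assume xy: "x \<in> S" "y \<in> S" "b x = b y" "x \<noteq> y"
    then have "dist x y \<le> dist x (b x) + dist y (b y)" by (simp add: dist_triangle2)
    also have "\<dots> < \<delta> + \<delta>" using b xy by (intro add_strict_mono) auto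
    finally show False using indep_dist[OF ind(1), of x y] xy \<delta> by auto
  qed
  moreover have "S' \<subseteq> b ` S"
  proof
    fix y assume y: "y \<in> S'"
    then obtain x where x: "x \<in> S" "dist x y < \<delta>" using 2 by blast
    have "dist (b x) y \<le> dist x (b x) + dist x y" by (metis dist_commute dist_triangle)
    also have "\<dots> < \<delta> + \<delta>" using b x by (intro add_strict_mono) auto
    finally have "b x = y" using indep_dist[OF ind(2), of "b x" y] b x y \<delta> by fastforce
    then show "y \<in> b ` S" using x by blast
  qed
  ultimately show ?thesis using b by (intro exI[of _ b]) auto
qed

lemma continuous_map_near_iff:
  "continuous_map (T n) euclideanreal F \<longleftrightarrow>
     (\<forall>S\<in>I n. ((\<lambda>b. F (b ` S)) \<longlongrightarrow> F S) (near n S))"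
proof (intro iffI ballI)
  fix S assume "continuous_map (T n) euclideanreal F" "S \<in> I n"
  then show "((\<lambda>b. F (b ` S)) \<longlongrightarrow> F S) (near n S)"
    using continuous_map_limit[OF _ limitin_near] by (fastforce simp: o_def)
next
  assume L: "\<forall>S\<in>I n. ((\<lambda>b. F (b ` S)) \<longlongrightarrow> F S) (near n S)"
  have "indep_open X \<epsilon> n {S \<in> I n. F S \<in> U}" if U: "open U" for U
    unfolding indep_open_def
  proof (intro conjI ballI impI)
    fix S assume S: "S \<in> {S \<in> I n. F S \<in> U}" "S \<noteq> {}"
    then have "\<forall>\<^sub>F b in near n S. F (b ` S) \<in> U"
      using L U by (auto intro: topological_tendstoD)
    then obtain d where d: "d > 0"
      "\<And>b. inj_on b S \<Longrightarrow> b ` S \<in> I n \<Longrightarrow> (\<forall>s\<in>S. dist s (b s) < d) \<Longrightarrow> F (b ` S) \<in> U"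
      unfolding eventually_near by blast
    have "F S' \<in> U" if S': "S' \<in> I n" "S' \<noteq> {}" "hausdorff_dist S S' < min d (\<epsilon> / 2)" for S'
    proof -
      have "S \<in> I n" using S by simp
      then obtain b where b: "inj_on b S" "b ` S = S'" "\<forall>s\<in>S. dist s (b s) < min d (\<epsilon> / 2)"
        using hausdorff_close_transport[OF _ S(2) S' min.cobounded2] by blast
      then show ?thesis using d(2)[of b] S' by auto
    qed
    then show "\<exists>\<delta>>0. \<forall>S'\<in>I n. S' \<noteq> {} \<and> hausdorff_dist S S' < \<delta> \<longrightarrow> S' \<in> {S \<in> I n. F S \<in> U}"
      using d eps_pos by (intro exI[of _ "min d (\<epsilon> / 2)"]) auto
  qed auto
  then show "continuous_map (T n) euclideanreal F"
    by (auto simp: continuous_map_def topspace_T openin_indep_topology)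
qed

lemma tendsto_transport:
  assumes "continuous_map (T m) euclideanreal F" "S \<in> I n" "R \<subseteq> S" "card R \<le> m"
  shows "((\<lambda>b. F (b ` R)) \<longlongrightarrow> F R) (near n S)"
proof -
  have "R \<in> I m" using I_subset[OF assms(2-4)] .
  then have "((\<lambda>b. F (b ` R)) \<longlongrightarrow> F R) (near m R)"
    using assms(1)[unfolded continuous_map_near_iff] by (simp only: Ball_def)
  then show ?thesis
    by (rule tendsto_mono[OF near_mono[OF assms(2-4)]])
qed

lemma tendsto_transport_pair:
  assumes K: "continuous_map (prod_topology (T m) (T m)) euclideanreal K"
    and S: "S \<in> I n" and J: "J \<in> small_subsets m S" "J' \<in> small_subsets m S"
  shows "((\<lambda>b. K (b ` J, b ` J')) \<longlongrightarrow> K (J, J')) (near n S)"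
proof -
  have l: "limitin (T m) (\<lambda>b. b ` J) J (near n S)" if "J \<in> small_subsets m S" for J
  proof -
    have "near n S \<le> near m J" "J \<in> I m"
      using that S by (auto simp: small_subsets_def intro: near_mono I_subset)
    then show ?thesis
      using limitin_near[of J m] by (auto simp: limitin_def filter_leD)
  qed
  have "limitin (prod_topology (T m) (T m)) (\<lambda>b. (b ` J, b ` J')) (J, J') (near n S)"
    using l J by (simp add: limitin_pairwise o_def)
  from continuous_map_limit[OF K this] show ?thesis by (simp add: o_def)
qed

text \<open>The form in which the criterion is used: \<open>G S b\<close> is \<open>F (b ` S)\<close> rewritten as an expression in \<open>S\<close> and the
moved points, whose limit can be taken term by term.\<close>

lemma continuous_map_nearI:
  assumes lim: "\<And>S. S \<in> I n \<Longrightarrow> (G S \<longlongrightarrow> F S) (near n S)"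
    and eq: "\<And>S b. S \<in> I n \<Longrightarrow> inj_on b S \<Longrightarrow> b ` S \<in> I n \<Longrightarrow> F (b ` S) = G S b"
  shows "continuous_map (T n) euclideanreal F"
proof (rule iffD2[OF continuous_map_near_iff], rule ballI)
  fix S assume S: "S \<in> I n"
  have e: "\<forall>\<^sub>F b in near n S. G S b = F (b ` S)"
    by (rule eventually_mono[OF eventually_near_inj[of S n]]) (use eq[OF S] in simp)
  have l: "(G S \<longlongrightarrow> F S) (near n S)"
    by (rule lim[OF S])
  show "((\<lambda>b. F (b ` S)) \<longlongrightarrow> F S) (near n S)"
    by (rule Lim_transform_eventually[OF l e])
qed

lemma continuous_mobius:
  assumes "continuous_map (T n) euclideanreal \<psi>"
  shows "continuous_map (T n) euclideanreal (mobius \<psi>)"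
proof (rule continuous_map_nearI)
  fix S assume S: "S \<in> I n"
  then have "card R \<le> n" if "R \<subseteq> S" for R
    using I_subset_same[OF S that] by (simp add: indep_sets_upto_def)
  then show "((\<lambda>b. \<Sum>R\<in>Pow S. (-1) ^ (card S + card R) * \<psi> (b ` R)) \<longlongrightarrow> mobius \<psi> S) (near n S)"
    unfolding mobius_def
    by (intro tendsto_intros tendsto_transport[OF assms S]) auto
  fix b :: "'a \<Rightarrow> 'a" assume b: "inj_on b S"
  then have "card (b ` R) = card R" if "R \<subseteq> S" for R
    using that by (meson card_image inj_on_subset)
  then show "mobius \<psi> (b ` S) = (\<Sum>R\<in>Pow S. (-1) ^ (card S + card R) * \<psi> (b ` R))"
    by (simp add: mobius_def sum_Pow_image[OF b])
qed

lemma continuous_pair_sum: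
  assumes "continuous_map (prod_topology (T t) (T t)) euclideanreal K"
  shows "continuous_map (T n) euclideanreal (pair_sum t K)"
proof (rule continuous_map_nearI)
  fix S assume S: "S \<in> I n"
  then show "((\<lambda>b. \<Sum>J\<in>small_subsets t S. \<Sum>J'\<in>small_subsets t S. K (b ` J, b ` J'))
      \<longlongrightarrow> pair_sum t K S) (near n S)"
    unfolding pair_sum_def
    by (intro tendsto_intros tendsto_transport_pair[OF assms S])
  fix b :: "'a \<Rightarrow> 'a" assume b: "inj_on b S"
  show "pair_sum t K (b ` S) = (\<Sum>J\<in>small_subsets t S. \<Sum>J'\<in>small_subsets t S. K (b ` J, b ` J'))"
    by (simp add: pair_sum_def sum_small_subsets_image[OF b])
qed

lemma continuous_sum_points:
  fixes h :: "'a \<Rightarrow> real"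
  assumes "continuous_on UNIV h"
  shows "continuous_map (T n) euclideanreal (\<lambda>R. \<Sum>x\<in>R. h x)"
proof (rule continuous_map_nearI)
  fix S
  show "((\<lambda>b. \<Sum>x\<in>S. h (b x)) \<longlongrightarrow> (\<Sum>x\<in>S. h x)) (near n S)"
    by (intro tendsto_sum continuous_on_tendsto_compose[OF assms tendsto_near_point]) auto
qed (simp add: sum.reindex)

lemma continuous_prod_points:
  fixes h :: "'a \<Rightarrow> real"
  assumes "continuous_on UNIV h"
  shows "continuous_map (T n) euclideanreal (\<lambda>R. \<Prod>x\<in>R. h x)"
proof (rule continuous_map_nearI)
  fix S
  show "((\<lambda>b. \<Prod>x\<in>S. h (b x)) \<longlongrightarrow> (\<Prod>x\<in>S. h x)) (near n S)"
    by (intro tendsto_prod continuous_on_tendsto_compose[OF assms tendsto_near_point]) auto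
qed (simp add: prod.reindex)

lemma continuous_card:
  fixes \<phi> :: "nat \<Rightarrow> real"
  shows "continuous_map (T n) euclideanreal (\<lambda>R. \<phi> (card R))"
  by (rule continuous_map_nearI[OF tendsto_const]) (simp add: card_image)

text \<open>Finite sets at Hausdorff distance less than \<open>e\<close> coincide once \<open>e\<close> is at most the smallest positive
distance between their points.\<close>

lemma closedin_T_singleton:
  assumes "S \<in> I n"
  shows "closedin (T n) {S}"
  unfolding closedin_def topspace_T openin_indep_topology indep_open_def
proof (intro conjI ballI impI)
  fix S' assume S': "S' \<in> I n - {S}" "S' \<noteq> {}"
  show "\<exists>\<delta>>0. \<forall>S''\<in>I n. S'' \<noteq> {} \<and> hausdorff_dist S' S'' < \<delta> \<longrightarrow> S'' \<in> I n - {S}"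
  proof (cases "S = {}")
    case False
    have fin: "finite S" "finite S'" using assms S' I_finite by auto
    let ?D = "(\<lambda>(x, y). dist x y) ` {p \<in> S' \<times> S. fst p \<noteq> snd p}"
    define e where "e = Min (insert 1 ?D)"
    have f: "finite (insert 1 ?D)" using fin by auto
    then have "e > 0" unfolding e_def by (subst Min_gr_iff) auto
    have e: "x = y" if "x \<in> S'" "y \<in> S" "dist x y < e" for x y
    proof (rule ccontr)
      assume "x \<noteq> y"
      then have "e \<le> dist x y"
        unfolding e_def using f that by (intro Min_le) (auto intro!: image_eqI[of _ _ "(x, y)"])
      with that show False by simp
    qed
    have "\<not> hausdorff_dist S' S < e"
    proof
      assume "hausdorff_dist S' S < e"
      then have 1: "\<forall>x\<in>S'. \<exists>y\<in>S. dist x y < e" and 2: "\<forall>y\<in>S. \<exists>x\<in>S'. dist x y < e"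
        using False S' fin by (auto simp: hausdorff_dist_less_iff)
      have "S' \<subseteq> S" using 1 e by blast
      moreover have "S \<subseteq> S'" using 2 e by blast
      ultimately show False using S' by blast
    qed
    then show ?thesis using \<open>e > 0\<close> by blast
  qed (auto intro: exI[of _ 1])
qed (use assms in auto)

text \<open>Cardinality is continuous, hence locally constant, so that bounding it cuts out a clopen part; near a
set of at most \<open>s\<close> points both spaces have the same members.\<close>

lemma subtopology_T:
  assumes "s \<le> t"
  shows "subtopology (T t) (I s) = T s" "openin (T t) (I s)" "closedin (T t) (I s)"
proof -
  have Is: "I s = {S \<in> topspace (T t). real (card S) \<in> {..<real s + 1}}"
       "I s = {S \<in> topspace (T t). real (card S) \<in> {..real s}}"
    using assms by (auto simp: topspace_T indep_sets_upto_def)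
  show o: "openin (T t) (I s)"
    unfolding Is(1) by (rule openin_continuous_map_preimage[OF continuous_card]) auto
  show "closedin (T t) (I s)"
    unfolding Is(2) by (rule closedin_continuous_map_preimage[OF continuous_card]) auto
  have "indep_open X \<epsilon> s U \<longleftrightarrow> indep_open X \<epsilon> t U \<and> U \<subseteq> I s" for U
  proof
    assume U: "indep_open X \<epsilon> s U"
    then have Us: "U \<subseteq> I s" by (simp add: indep_open_def)
    have "indep_open X \<epsilon> t U"
      unfolding indep_open_def
    proof (intro conjI ballI impI)
      show "U \<subseteq> I t" using Us I_mono[OF assms] by auto
      fix S assume S: "S \<in> U" "S \<noteq> {}"
      then obtain d where d: "d > 0"
        "\<And>S'. S' \<in> I s \<Longrightarrow> S' \<noteq> {} \<Longrightarrow> hausdorff_dist S S' < d \<Longrightarrow> S' \<in> U"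
        using indep_openD[OF U S] by blast
      have "S' \<in> U" if S': "S' \<in> I t" "S' \<noteq> {}" "hausdorff_dist S S' < min d (\<epsilon> / 2)" for S'
      proof -
        have "S \<in> I s" using S Us by blast
        then obtain b where "inj_on b S" "b ` S = S'"
          using hausdorff_close_transport[OF _ S(2) S' min.cobounded2] by blast
        then have "card S' = card S" using card_image by blast
        then have "S' \<in> I s" using S S' Us by (auto simp: indep_sets_upto_def)
        then show ?thesis using d S' by auto
      qed
      then show "\<exists>\<delta>>0. \<forall>S'\<in>I t. S' \<noteq> {} \<and> hausdorff_dist S S' < \<delta> \<longrightarrow> S' \<in> U"
        using d eps_pos by (intro exI[of _ "min d (\<epsilon> / 2)"]) auto
    qed
    then show "indep_open X \<epsilon> t U \<and> U \<subseteq> I s" using Us by blast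
  next
    assume U: "indep_open X \<epsilon> t U \<and> U \<subseteq> I s"
    show "indep_open X \<epsilon> s U"
      unfolding indep_open_def
    proof (intro conjI ballI impI)
      fix S assume "S \<in> U" "S \<noteq> {}"
      then obtain d where "d > 0"
        "\<And>S'. S' \<in> I t \<Longrightarrow> S' \<noteq> {} \<Longrightarrow> hausdorff_dist S S' < d \<Longrightarrow> S' \<in> U"
        using indep_openD[of t U S] U by blast
      then show "\<exists>\<delta>>0. \<forall>S'\<in>I s. S' \<noteq> {} \<and> hausdorff_dist S S' < \<delta> \<longrightarrow> S' \<in> U"
        using I_mono[OF assms] by (intro exI[of _ d]) blast
    qed (use U in blast)
  qed
  then show "subtopology (T t) (I s) = T s"
    using o by (simp add: topology_eq openin_open_subtopology openin_indep_topology)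
qed

text \<open>The nonempty members of \<open>I n\<close> are the ranges of \<open>n\<close>-tuples of points of \<open>X\<close>, repetitions allowed. The
tuples with independent range form a closed subset of \<open>X\<^sup>n\<close>, because being adjacent is an open
condition on pairs, and taking the range is continuous for the Hausdorff distance.\<close>

lemma compact_space_T: "compact_space (T n)"
proof -
  define P where "P = product_topology (\<lambda>_::nat. top_of_set X) {..<n}"
  define O' where "O' = (\<Union>w\<in>X. {p::'a \<times> 'a. fst p \<noteq> snd p \<and> dist (fst p) w < \<epsilon> \<and> dist (snd p) w < \<epsilon>})"
  \<comment> \<open>\<open>O'\<close> is adjacency in the packing graph; \<open>W\<close> consists of the tuples with independent range.\<close>
  define W where "W = {x \<in> topspace P. \<forall>i<n. \<forall>j<n. (x i, x j) \<notin> O'}"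
  have tP: "topspace P = (\<Pi>\<^sub>E i\<in>{..<n}. X)" by (simp add: P_def)
  have cP: "compact_space P"
    using compact_X by (simp add: P_def compact_space_product_topology compact_space_subtopology)
  have pr: "continuous_map P euclidean (\<lambda>x. x i)" if "i < n" for i
  proof -
    have "continuous_map P (top_of_set X) (\<lambda>x. x i)"
      unfolding P_def by (rule continuous_map_product_projection) (use that in auto)
    then show ?thesis by (rule continuous_map_into_fulltopology)
  qed
  have "open O'"
    unfolding O'_def by (intro open_UN ballI open_Collect_conj open_Collect_neq open_Collect_less continuous_intros)
  have "closedin P W"
  proof -
    have "openin P {x \<in> topspace P. (x i, x j) \<in> O'}" if "i < n" "j < n" for i j
    proof (rule openin_continuous_map_preimage)
      show "continuous_map P euclidean (\<lambda>x. (x i, x j))"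
        using continuous_map_pairedI[OF pr[OF that(1)] pr[OF that(2)]] by simp
    qed (use \<open>open O'\<close> in simp)
    then have "openin P (\<Union>i\<in>{..<n}. \<Union>j\<in>{..<n}. {x \<in> topspace P. (x i, x j) \<in> O'})"
      by (intro openin_Union) auto
    moreover have "topspace P - W = (\<Union>i\<in>{..<n}. \<Union>j\<in>{..<n}. {x \<in> topspace P. (x i, x j) \<in> O'})"
      by (auto simp: W_def)
    ultimately show ?thesis by (auto simp: closedin_def W_def)
  qed
  then have cW: "compactin P W"
    using cP closedin_compact_space by blast
  have W_indep: "packing_independent X \<epsilon> (x ` {..<n}) \<longleftrightarrow> x \<in> W" if "x \<in> topspace P" for x
  proof -
    have X: "x i \<in> X" if "i < n" for i using \<open>x \<in> topspace P\<close> that by (auto simp: tP)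
    have "packing_adjacent X \<epsilon> (x i) (x j) \<longleftrightarrow> (x i, x j) \<in> O'" if "i < n" "j < n" for i j
      using X that by (auto simp: packing_adjacent_def O'_def)
    then show ?thesis using X that by (auto simp: packing_independent_def W_def)
  qed
  have "compactin (T n) (I n - {{}})"
  proof (cases "n = 0")
    case True
    then have "I n - {{}} = {}" by (auto simp: indep_sets_upto_def)
    then show ?thesis by (simp only: compactin_empty)
  next
    case False
    let ?f = "\<lambda>x. x ` {..<n}"
    have cont: "continuous_map (subtopology P W) (T n) ?f"
      unfolding continuous_map_def
    proof (intro conjI allI impI)
      have *: "?f x \<in> I n" if "x \<in> W" for x
        using that W_indep[of x] card_image_le[of "{..<n}" x]
        by (auto simp: W_def indep_sets_upto_def)
      then show "?f \<in> topspace (subtopology P W) \<rightarrow> topspace (T n)"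
        by (auto simp: topspace_T)
      fix U assume "openin (T n) U"
      then have U: "indep_open X \<epsilon> n U" by (simp add: openin_indep_topology)
      show "openin (subtopology P W) {x \<in> topspace (subtopology P W). ?f x \<in> U}"
      proof (subst openin_subopen, intro ballI)
        fix x assume "x \<in> {x \<in> topspace (subtopology P W). ?f x \<in> U}"
        then have x: "x \<in> W" "x \<in> topspace P" "?f x \<in> U" by auto
        obtain d where d: "d > 0"
          "\<And>S'. S' \<in> I n \<Longrightarrow> S' \<noteq> {} \<Longrightarrow> hausdorff_dist (?f x) S' < d \<Longrightarrow> S' \<in> U"
          using indep_openD[OF U x(3)] False by auto
        define V where "V = (\<Inter>i\<in>{..<n}. {y \<in> topspace P. y i \<in> ball (x i) d})"
        have "openin P V"
          unfolding V_def
        proof (intro openin_INT2)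
          fix i assume "i \<in> {..<n}"
          then show "openin P {y \<in> topspace P. y i \<in> ball (x i) d}"
            by (intro openin_continuous_map_preimage[OF pr]) auto
        qed (use False in auto)
        then have o: "openin (subtopology P W) (V \<inter> W)"
          by (auto simp: openin_subtopology)
        have "x \<in> V" using x d by (auto simp: V_def)
        have "?f y \<in> U" if y: "y \<in> V" "y \<in> W" for y
        proof (rule d(2))
          have "dist (x i) (y i) < d" if "i < n" for i
            using y that by (auto simp: V_def)
          then show "hausdorff_dist (?f x) (?f y) < d"
            using False by (subst hausdorff_dist_less_iff) auto
        qed (use * y False in auto)
        then have "V \<inter> W \<subseteq> {x \<in> topspace (subtopology P W). ?f x \<in> U}"
          by (auto simp: W_def)
        with o \<open>x \<in> V\<close> x show "\<exists>A. openin (subtopology P W) A \<and> x \<in> A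
            \<and> A \<subseteq> {x \<in> topspace (subtopology P W). ?f x \<in> U}"
          by (intro exI[of _ "V \<inter> W"]) auto
      qed
    qed
    have "I n - {{}} \<subseteq> ?f ` W"
    proof
      fix S assume S: "S \<in> I n - {{}}"
      then have fin: "finite S" "card S \<le> n" "S \<noteq> {}" and ind: "packing_independent X \<epsilon> S"
        by (auto simp: indep_sets_upto_def)
      obtain h where h: "bij_betw h {0..<card S} S"
        using ex_bij_betw_nat_finite[OF fin(1)] by blast
      \<comment> \<open>An enumeration of \<open>S\<close>, padded to length \<open>n\<close> by repeating its first point.\<close>
      define x where "x = (\<lambda>i\<in>{..<n}. h (if i < card S then i else 0))"
      have c: "0 < card S" using fin by (simp add: card_gt_0_iff)
      have fx: "?f x = S"
      proof
        show "?f x \<subseteq> S" using h c by (auto simp: x_def bij_betw_def)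
        show "S \<subseteq> ?f x"
        proof
          fix s assume "s \<in> S"
          then have "s \<in> h ` {0..<card S}" using h by (simp add: bij_betw_def)
          then obtain i where "i < card S" "s = h i" by auto
          then show "s \<in> ?f x" using fin by (intro image_eqI[of _ _ i]) (auto simp: x_def)
        qed
      qed
      have "S \<subseteq> X" using ind by (simp add: packing_independent_def)
      then have "x \<in> topspace P" using fx by (auto simp: tP x_def)
      then have "x \<in> W" using W_indep[of x] ind fx by simp
      then show "S \<in> ?f ` W" using fx by blast
    qed
    moreover have "?f ` W \<subseteq> I n - {{}}"
      using continuous_map_image_subset_topspace[OF cont] False
      by (auto simp: topspace_T W_def)
    moreover have "compactin (T n) (?f ` W)"
      using cont cW by (intro image_compactin[OF _ cont]) (simp add: compactin_subtopology)
    ultimately show ?thesis by (metis subset_antisym)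
  qed
  moreover have "compactin (T n) {{}}"
    by (rule finite_imp_compactin) (auto simp: topspace_T empty_in_I)
  ultimately have "compactin (T n) ((I n - {{}}) \<union> {{}})"
    by (rule compactin_Un)
  moreover have "(I n - {{}}) \<union> {{}} = I n" using empty_in_I by auto
  ultimately show ?thesis by (simp add: compact_space_def topspace_T)
qed

text \<open>Each ball of a finite cover of \<open>X\<close> by balls of radius \<open>\<epsilon> / 2\<close> contains at most one point of an
independent set.\<close>

lemma indep_card_bounded:
  "\<exists>m. \<forall>S. packing_independent X \<epsilon> S \<longrightarrow> finite S \<and> card S \<le> m"
proof -
  obtain k where k: "finite k" "X \<subseteq> (\<Union>x\<in>k. ball x (\<epsilon> / 2))"
    using compact_X eps_pos unfolding compact_eq_totally_bounded by (metis half_gt_zero)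
  have "finite S \<and> card S \<le> card k" if S: "packing_independent X \<epsilon> S" for S
  proof -
    have "S \<subseteq> X" using S by (simp add: packing_independent_def)
    then have "\<forall>s\<in>S. \<exists>x\<in>k. dist x s < \<epsilon> / 2" using k by fastforce
    then obtain c where c: "\<forall>s\<in>S. c s \<in> k \<and> dist (c s) s < \<epsilon> / 2" by metis
    have "inj_on c S"
    proof (rule inj_onI, rule ccontr)
      fix x y assume xy: "x \<in> S" "y \<in> S" "c x = c y" "x \<noteq> y"
      have "dist x y \<le> dist (c x) x + dist (c y) y" using xy by (metis dist_triangle3)
      also have "\<dots> < \<epsilon> / 2 + \<epsilon> / 2" using c xy by (intro add_strict_mono) auto
      finally show False using indep_dist[OF S, of x y] xy by auto
    qed
    moreover have "c ` S \<subseteq> k" using c by auto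
    ultimately show ?thesis
      using k by (meson card_inj_on_le finite_imageD finite_subset)
  qed
  then show ?thesis by blast
qed

lemma alpha_finite: "finite {card S |S. finite S \<and> packing_independent X \<epsilon> S}"
proof -
  obtain m where m: "\<forall>S. packing_independent X \<epsilon> S \<longrightarrow> finite S \<and> card S \<le> m"
    using indep_card_bounded by (rule exE)
  have "{card S |S. finite S \<and> packing_independent X \<epsilon> S} \<subseteq> {..m}"
    using m by blast
  then show ?thesis by (rule finite_subset) simp
qed

lemma indep_card_le_alpha:
  assumes "packing_independent X \<epsilon> S"
  shows "finite S" "card S \<le> packing_alpha X \<epsilon>"
proof -
  obtain m where m: "\<forall>S. packing_independent X \<epsilon> S \<longrightarrow> finite S \<and> card S \<le> m"
    using indep_card_bounded by (rule exE)
  show "finite S" using m assms by blast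
  then show "card S \<le> packing_alpha X \<epsilon>"
    unfolding packing_alpha_def using assms by (intro Max_ge[OF alpha_finite]) auto
qed

lemma I_eq_alpha:
  assumes "packing_alpha X \<epsilon> \<le> n"
  shows "I n = {S. packing_independent X \<epsilon> S}"
  using assms indep_card_le_alpha by (force simp: indep_sets_upto_def)

lemma alpha_pos_iff: "1 \<le> packing_alpha X \<epsilon> \<longleftrightarrow> X \<noteq> {}"
proof
  assume "X \<noteq> {}"
  then obtain x where "x \<in> X" by blast
  then have "packing_independent X \<epsilon> {x}"
    by (auto simp: packing_independent_def packing_adjacent_def)
  from indep_card_le_alpha(2)[OF this] show "1 \<le> packing_alpha X \<epsilon>" by simp
next
  assume a: "1 \<le> packing_alpha X \<epsilon>"
  have "packing_alpha X \<epsilon> \<in> {card S |S. finite S \<and> packing_independent X \<epsilon> S}"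
    unfolding packing_alpha_def
    by (rule Max_in[OF alpha_finite]) (auto simp: packing_independent_def intro: exI[of _ "{}"])
  then show "X \<noteq> {}" using a by (auto simp: packing_independent_def)
qed

section \<open>Monotonicity of the hierarchy\<close>

text \<open>The subsets of \<open>R\<close> that lie in \<open>I s\<close> are its subsets of size at most \<open>s\<close>.\<close>

lemma pair_sum_extend_zero:
  assumes "R \<in> I n" "s \<le> t"
  shows "pair_sum t (\<lambda>p. indicator (I s \<times> I s) p * K p) R = pair_sum s K R"
proof -
  have "pair_sum t (\<lambda>p. indicator (I s \<times> I s) p * K p) R
      = (\<Sum>p\<in>small_subsets t R \<times> small_subsets t R. indicator (I s \<times> I s) p * K p)"
    by (simp add: pair_sum_def sum.cartesian_product)
  also have "\<dots> = (\<Sum>p\<in>small_subsets s R \<times> small_subsets s R. K p)"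
  proof (rule sum.mono_neutral_cong_right)
    show "finite (small_subsets t R \<times> small_subsets t R)"
      by (intro finite_cartesian_product finite_small_subsets I_finite[OF assms(1)])
    show "small_subsets s R \<times> small_subsets s R \<subseteq> small_subsets t R \<times> small_subsets t R"
      using assms by (auto simp: small_subsets_def)
    have "J \<in> I s \<longleftrightarrow> J \<in> small_subsets s R" if "J \<in> small_subsets t R" for J
      using that I_subset[OF assms(1), of J s] by (auto simp: small_subsets_def indep_sets_upto_def)
    then show "\<forall>p\<in>small_subsets t R \<times> small_subsets t R - small_subsets s R \<times> small_subsets s R.
        indicator (I s \<times> I s) p * K p = 0"
      by (auto simp: indicator_def)
    show "indicator (I s \<times> I s) p * K p = K p" if "p \<in> small_subsets s R \<times> small_subsets s R" for p
      using that I_subset[OF assms(1)] by (auto simp: small_subsets_def)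
  qed
  also have "\<dots> = pair_sum s K R"
    by (simp add: pair_sum_def sum.cartesian_product)
  finally show ?thesis .
qed

text \<open>A union of two sets of size at most \<open>s\<close> has at most \<open>2 * s \<le> m\<close> points.\<close>

lemma A_op_extend_zero:
  assumes S: "S \<in> I n" and st: "s \<le> t" and m: "2 * s \<le> m"
  shows "A_op X \<epsilon> t (\<lambda>p. indicator (I s \<times> I s) p * K p) S = indicator (I m) S * A_op X \<epsilon> s K S"
proof -
  have S': "finite S" "packing_independent X \<epsilon> S" using S by (auto simp: indep_sets_upto_def)
  have "A_op X \<epsilon> t (\<lambda>p. indicator (I s \<times> I s) p * K p) S = A_op X \<epsilon> s K S"
    unfolding A_op_eq_mobius[OF S']
    by (intro mobius_cong pair_sum_extend_zero[OF I_subset_same[OF S] st])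
  moreover have "A_op X \<epsilon> s K S = 0" if "S \<notin> I m"
  proof -
    have "J \<union> J' \<noteq> S" if "J \<in> I s" "J' \<in> I s" for J J'
    proof
      assume "J \<union> J' = S"
      then have "card S \<le> m" using that card_Un_le[of J J'] m by (auto simp: indep_sets_upto_def)
      then show False using S \<open>S \<notin> I m\<close> by (auto simp: indep_sets_upto_def)
    qed
    then have "{(J, J'). J \<in> I s \<and> J' \<in> I s \<and> J \<union> J' = S} = {}" by auto
    then show ?thesis unfolding A_op_def by (simp only: sum.empty)
  qed
  ultimately show ?thesis by (auto simp: indicator_def)
qed

lemma B_op_extend_zero:
  assumes S: "S \<in> I n" and st: "s \<le> t" and m: "2 * s + 1 \<le> m"
  shows "B_op X r \<epsilon> t z (\<lambda>p. indicator (I s \<times> I s) p * K p) S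
       = indicator (I m) S * B_op X r \<epsilon> s z K S"
proof -
  have S': "finite S" "packing_independent X \<epsilon> S" using S by (auto simp: indep_sets_upto_def)
  have "B_op X r \<epsilon> t z (\<lambda>p. indicator (I s \<times> I s) p * K p) S = B_op X r \<epsilon> s z K S"
    unfolding B_op_eq_mobius[OF S']
    by (intro mobius_cong arg_cong2[where f = "(*)"] refl pair_sum_extend_zero[OF I_subset_same[OF S] st])
  moreover have "B_op X r \<epsilon> s z K S = 0" if "S \<notin> I m"
  proof -
    have "J \<union> J' \<union> A \<noteq> S" if "J \<in> I s" "J' \<in> I s" "card A \<le> 1" for J J' A
    proof
      assume "J \<union> J' \<union> A = S"
      then have "card S \<le> m" using that card_Un_le[of J J'] card_Un_le[of "J \<union> J'" A] m
        by (auto simp: indep_sets_upto_def)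
      then show False using S \<open>S \<notin> I m\<close> by (auto simp: indep_sets_upto_def)
    qed
    from this[of _ _ "{_}"] this[of _ _ "{}"]
    have "{(x, J, J'). x \<in> cball z r \<inter> X \<and> J \<in> I s \<and> J' \<in> I s \<and> J \<union> J' \<union> {x} = S} = {}"
      "{(J, J'). J \<in> I s \<and> J' \<in> I s \<and> J \<union> J' = S} = {}" by auto
    then show ?thesis unfolding B_op_def by (simp only: sum.empty)
  qed
  ultimately show ?thesis by (auto simp: indicator_def)
qed

text \<open>The common part of the two families of constraints: \<open>F\<close> and \<open>G\<close> are the operators of the larger and the
smaller step, and the hypothesis on them says that \<open>F\<close> applied to an extended kernel lives on \<open>I m\<close>
and agrees with \<open>G\<close> there.\<close>

lemma adjoint_restrict:
  assumes lam: "lam \<in> radon_measures (T n)" and st: "s \<le> t" and mn: "m \<le> n"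
    and op: "\<And>K S. S \<in> I n \<Longrightarrow>
      F (\<lambda>p. indicator (I s \<times> I s) p * K p) S = indicator (I m) S * G K S"
    and \<nu>: "\<nu> \<in> psd_measures (T t)" "is_adjoint_image (T t) F lam \<nu>"
  shows "\<exists>\<nu>\<in>psd_measures (T s). is_adjoint_image (T s) G (restrict_space lam (I m)) \<nu>"
proof -
  note Y = subtopology_T(2,3)[OF st]
  obtain \<nu>' where \<nu>': "\<nu>' \<in> psd_measures (T s)"
    and eq: "\<And>K. K \<in> sym_kernels (T s) \<Longrightarrow> signed_integral (prod_topology (T s) (T s)) K \<nu>'
      = signed_integral (prod_topology (T t) (T t)) (\<lambda>p. indicator (I s \<times> I s) p * K p) \<nu>"
    using psd_measure_restrict[OF compact_space_T Y \<nu>(1)] unfolding subtopology_T(1)[OF st] by blast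
  have sp: "space lam = I n" using lam by (simp add: radon_measures_def topspace_T)
  have meas: "I m \<inter> space lam \<in> sets lam"
    using lam borel_sets_of_openin[OF subtopology_T(2)[OF mn]] I_mono[OF mn]
    by (simp add: sp radon_measures_def Int_absorb2)
  have "signed_integral (prod_topology (T s) (T s)) K \<nu>' = (\<integral>S. G K S \<partial>restrict_space lam (I m))"
    if K: "K \<in> sym_kernels (T s)" for K
  proof -
    have "(\<lambda>p. indicator (I s \<times> I s) p * K p) \<in> sym_kernels (T t)"
      using sym_kernel_extend_zero[OF Y] K unfolding subtopology_T(1)[OF st] by blast
    then have "signed_integral (prod_topology (T s) (T s)) K \<nu>'
        = (\<integral>S. F (\<lambda>p. indicator (I s \<times> I s) p * K p) S \<partial>lam)"
      using \<nu>(2) eq[OF K] by (simp add: is_adjoint_image_def)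
    also have "\<dots> = (\<integral>S. indicator (I m) S *\<^sub>R G K S \<partial>lam)"
      by (rule Bochner_Integration.integral_cong) (simp_all add: sp op)
    also have "\<dots> = (\<integral>S. G K S \<partial>restrict_space lam (I m))"
      by (rule integral_restrict_space[OF meas, symmetric])
    finally show ?thesis .
  qed
  then show ?thesis using \<nu>' by (auto simp: is_adjoint_image_def psd_measures_def)
qed

lemma las_feasible_B_op:
  assumes "lam \<in> las_feasible X r \<epsilon> t" "z \<in> X"
  shows "\<exists>\<nu>\<in>psd_measures (T (t - 1)). is_adjoint_image (T (t - 1)) (B_op X r \<epsilon> (t - 1) z) lam \<nu>"
  using assms(1) unfolding las_feasible_def mem_Collect_eq
  by (elim conjE) (erule bspec[OF _ assms(2)])

lemma las_feasible_restrict: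
  assumes s: "1 \<le> s" "s \<le> t" and lam: "lam \<in> las_feasible X r \<epsilon> t"
  shows "restrict_space lam (I (2 * s)) \<in> las_feasible X r \<epsilon> s"
    and "measure (restrict_space lam (I (2 * s))) (indep_singletons X \<epsilon>) = measure lam (indep_singletons X \<epsilon>)"
proof -
  let ?L = "restrict_space lam (I (2 * s))"
  have rad: "lam \<in> radon_measures (T (2 * t))" and e: "measure lam {{}} = 1"
    using lam by (auto simp: las_feasible_def)
  have st: "2 * s \<le> 2 * t" using s by simp
  have rL: "?L \<in> radon_measures (T (2 * s))"
    using restrict_space_radon[OF rad subtopology_T(2)[OF st]] by (simp add: subtopology_T(1)[OF st])
  have meas: "I (2 * s) \<inter> space lam \<in> sets lam"
    using rad borel_sets_of_openin[OF subtopology_T(2)[OF st]] I_mono[OF st]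
    by (simp add: radon_measures_def topspace_T Int_absorb2)
  have m: "measure ?L A = measure lam A" if "A \<subseteq> I (2 * s)" for A
    by (rule measure_restrict_space[OF meas that])
  have "indep_singletons X \<epsilon> \<subseteq> I (2 * s)"
    using s by (auto simp: indep_singletons_def indep_sets_upto_def card_1_singleton_iff)
  then show "measure ?L (indep_singletons X \<epsilon>) = measure lam (indep_singletons X \<epsilon>)"
    by (rule m)
  have "measure ?L {{}} = 1"
    using e by (subst m) (auto simp: empty_in_I)
  moreover have "\<exists>\<nu>\<in>psd_measures (T s). is_adjoint_image (T s) (A_op X \<epsilon> s) ?L \<nu>"
  proof -
    obtain \<nu> where \<nu>: "\<nu> \<in> psd_measures (T t)" "is_adjoint_image (T t) (A_op X \<epsilon> t) lam \<nu>"
      using lam by (auto simp: las_feasible_def)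
    show ?thesis
      by (rule adjoint_restrict[OF rad s(2) st _ \<nu>]) (rule A_op_extend_zero[OF _ s(2)], auto)
  qed
  moreover have "\<exists>\<nu>\<in>psd_measures (T (s - 1)). is_adjoint_image (T (s - 1)) (B_op X r \<epsilon> (s - 1) z) ?L \<nu>"
    if z: "z \<in> X" for z
  proof -
    obtain \<nu> where \<nu>: "\<nu> \<in> psd_measures (T (t - 1))"
        "is_adjoint_image (T (t - 1)) (B_op X r \<epsilon> (t - 1) z) lam \<nu>"
      using las_feasible_B_op[OF lam z] by (rule bexE)
    have st': "s - 1 \<le> t - 1" using s by simp
    show ?thesis
      by (rule adjoint_restrict[OF rad st' st _ \<nu>])
        (rule B_op_extend_zero[OF _ st'], use s in auto)
  qed
  ultimately show "?L \<in> las_feasible X r \<epsilon> s"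
    using rL by (simp add: las_feasible_def)
qed

lemma las_mono:
  assumes "1 \<le> s" "s \<le> t"
  shows "las X r \<epsilon> s \<le> las X r \<epsilon> t"
  unfolding las_def
proof (rule INF_greatest)
  fix lam assume lam: "lam \<in> las_feasible X r \<epsilon> t"
  show "(INF lam\<in>las_feasible X r \<epsilon> s. ereal (measure lam (indep_singletons X \<epsilon>)))
      \<le> ereal (measure lam (indep_singletons X \<epsilon>))"
    using INF_lower[OF las_feasible_restrict(1)[OF assms lam],
        of "\<lambda>lam. ereal (measure lam (indep_singletons X \<epsilon>))"]
    by (simp add: las_feasible_restrict(2)[OF assms lam])
qed

section \<open>Measurability of the operators\<close>

text \<open>Continuous functions that equal \<open>1\<close> on the closed ball around \<open>z\<close> and decrease to its indicator.\<close>

definition bump :: "'a \<Rightarrow> real \<Rightarrow> nat \<Rightarrow> 'a \<Rightarrow> real" where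
  "bump z r k x = max 0 (1 - real k * max 0 (dist z x - r))"

lemma bump_continuous: "continuous_on UNIV (bump z r k)"
  unfolding bump_def by (intro continuous_intros)

lemma bump_bounds: "0 \<le> bump z r k x" "bump z r k x \<le> 1"
  by (auto simp: bump_def)

lemma bump_antimono: "j \<le> k \<Longrightarrow> bump z r k x \<le> bump z r j x"
  unfolding bump_def by (intro max.mono order_refl diff_left_mono mult_right_mono) auto

lemma bump_tendsto: "(\<lambda>k. bump z r k x) \<longlonglongrightarrow> of_bool (x \<in> cball z r)"
proof (cases "dist z x \<le> r")
  case False
  obtain k0 where k0: "1 / (dist z x - r) \<le> real k0" using real_arch_simple by blast
  have "bump z r k x = 0" if "k \<ge> k0" for k
  proof -
    have "1 / (dist z x - r) \<le> real k" using k0 that by linarith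
    then have "1 \<le> real k * (dist z x - r)" using False by (simp add: field_simps)
    then show ?thesis using False by (simp add: bump_def)
  qed
  then have "\<forall>\<^sub>F k in sequentially. 0 = bump z r k x"
    unfolding eventually_sequentially by (intro exI[of _ k0]) auto
  then show ?thesis using False by (auto intro: Lim_transform_eventually[OF tendsto_const])
qed (simp add: bump_def)

lemma sum_bump_tendsto:
  assumes "finite R"
  shows "(\<lambda>k. \<Sum>x\<in>R. bump z r k x) \<longlonglongrightarrow> real (card (R \<inter> cball z r))"
proof -
  have "(\<Sum>x\<in>R. of_bool (x \<in> cball z r)) = real (card (R \<inter> cball z r))"
    using assms by (simp add: of_bool_def sum.If_cases Int_def)
  moreover have "(\<lambda>k. \<Sum>x\<in>R. bump z r k x) \<longlonglongrightarrow> (\<Sum>x\<in>R. of_bool (x \<in> cball z r))"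
    by (intro tendsto_sum bump_tendsto)
  ultimately show ?thesis by (simp only:)
qed

lemma space_radon: "lam \<in> radon_measures (T n) \<Longrightarrow> space lam = I n"
  by (simp add: radon_measures_def topspace_T)

lemma A_op_measurable:
  assumes "lam \<in> radon_measures (T n)" "K \<in> sym_kernels (T u)"
  shows "A_op X \<epsilon> u K \<in> borel_measurable lam"
proof -
  have "continuous_map (T n) euclideanreal (mobius (pair_sum u K))"
    using assms by (intro continuous_mobius continuous_pair_sum) (simp add: sym_kernels_def)
  then have "mobius (pair_sum u K) \<in> borel_measurable lam"
    by (rule continuous_map_borel_measurable[OF assms(1)])
  moreover have "A_op X \<epsilon> u K S = mobius (pair_sum u K) S" if "S \<in> space lam" for S
    using that A_op_eq_mobius[of S X] by (simp add: space_radon[OF assms(1)] indep_sets_upto_def)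
  ultimately show ?thesis by (simp cong: measurable_cong)
qed

text \<open>\<open>B_op\<close> is the Moebius transform of \<open>(card (R \<inter> cball z r) - 1) * pair_sum u K R\<close>, and the number of
points in the closed ball is the limit of the continuous functions \<open>\<Sum>x\<in>R. bump z r k x\<close>.\<close>

lemma B_op_measurable:
  assumes "lam \<in> radon_measures (T n)" "K \<in> sym_kernels (T u)"
  shows "B_op X r \<epsilon> u z K \<in> borel_measurable lam"
proof (rule borel_measurable_LIMSEQ_real)
  let ?\<psi> = "\<lambda>k R. ((\<Sum>x\<in>R. bump z r k x) - 1) * pair_sum u K R"
  fix k
  have "continuous_map (T n) euclideanreal (?\<psi> k)"
    using assms by (intro continuous_map_real_mult continuous_map_diff continuous_sum_points bump_continuous
        continuous_map_const[THEN iffD2] continuous_pair_sum) (auto simp: sym_kernels_def)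
  then show "mobius (?\<psi> k) \<in> borel_measurable lam"
    by (intro continuous_map_borel_measurable[OF assms(1)] continuous_mobius)
next
  let ?\<psi> = "\<lambda>k R. ((\<Sum>x\<in>R. bump z r k x) - 1) * pair_sum u K R"
  fix S assume "S \<in> space lam"
  then have S: "finite S" "packing_independent X \<epsilon> S"
    by (auto simp: space_radon[OF assms(1)] indep_sets_upto_def)
  show "(\<lambda>k. mobius (?\<psi> k) S) \<longlonglongrightarrow> B_op X r \<epsilon> u z K S"
    unfolding B_op_eq_mobius[OF S] unfolding mobius_def
    by (intro tendsto_intros sum_bump_tendsto) (use S in \<open>auto dest: finite_subset\<close>)
qed

section \<open>Coverings give feasible measures\<close>

text \<open>The image measure puts mass \<open>c\<close> on every pair of small subsets of \<open>Z\<close>. It is positive because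
\<open>pair_sum u K Z\<close> is a quadratic form of \<open>K\<close> with all coefficients equal to \<open>1\<close>.\<close>

lemma adjoint_point_masses:
  assumes Z: "finite Z" "packing_independent X \<epsilon> Z" and c: "0 \<le> c"
    and op: "\<And>K. K \<in> sym_kernels (T u) \<Longrightarrow> (\<integral>S. F K S \<partial>lam) = c * pair_sum u K Z"
  shows "\<exists>\<nu>\<in>psd_measures (T u). is_adjoint_image (T u) F lam \<nu>"
proof -
  let ?Q = "small_subsets u Z" and ?P = "prod_topology (T u) (T u)"
  let ?M = "point_masses ?P (?Q \<times> ?Q) (\<lambda>_. c)"
  have cP: "compact_space ?P" by (simp add: compact_space_prod_topology compact_space_T)
  have fin: "finite ?Q" using Z by (simp add: finite_small_subsets)
  have QI: "J \<in> I u" if "J \<in> ?Q" for J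
    using that Z by (auto simp: small_subsets_def indep_sets_upto_def
        intro: finite_subset packing_independent_subset)
  have F1: "finite (?Q \<times> ?Q)" using fin by simp
  have F2: "closedin ?P {p}" if "p \<in> ?Q \<times> ?Q" for p
  proof -
    have p: "{p} = {fst p} \<times> {snd p}" by auto
    have "closedin (T u) {fst p}" "closedin (T u) {snd p}"
      using that QI by (auto intro!: closedin_T_singleton)
    then show ?thesis unfolding p by (subst closedin_prod_Times_iff) blast
  qed
  have F3: "0 \<le> c" if "p \<in> ?Q \<times> ?Q" for p :: "'a set \<times> 'a set" by (rule c)
  have sym: "measure ?M (prod.swap ` E) = measure ?M E" if E: "E \<in> borel_sets_of ?P" for E
  proof -
    have "prod.swap ` E \<in> borel_sets_of ?P" by (rule borel_sets_of_swap[OF E])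
    then have "measure ?M (prod.swap ` E) = (\<Sum>x\<in>(?Q \<times> ?Q) \<inter> prod.swap ` E. c)"
      by (intro measure_point_masses F1 F2 F3)
    also have "(?Q \<times> ?Q) \<inter> prod.swap ` E = prod.swap ` ((?Q \<times> ?Q) \<inter> E)" by auto
    also have "(\<Sum>x\<in>\<dots>. c) = (\<Sum>x\<in>(?Q \<times> ?Q) \<inter> E. c)"
      by (subst sum.reindex) auto
    also have "\<dots> = measure ?M E"
      using E by (intro measure_point_masses[symmetric] F1 F2 F3)
    finally show ?thesis .
  qed
  have int: "signed_integral ?P K (measure ?M) = c * pair_sum u K Z" if "K \<in> sym_kernels (T u)" for K
  proof -
    have "signed_integral ?P K (measure ?M) = (\<Sum>p\<in>?Q \<times> ?Q. c * K p)"
      using that by (intro signed_integral_point_masses cP F1 F2 F3) (auto simp: sym_kernels_def)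
    then show ?thesis by (simp add: pair_sum_def sum.cartesian_product sum_distrib_left)
  qed
  have s: "measure ?M \<in> sym_radon_measures (T u)"
    unfolding sym_radon_measures_def using sym by (auto intro!: measure_point_masses_signed F1 F2 F3)
  have "0 \<le> pair_sum u K Z" if K: "K \<in> psd_kernels (T u)" for K
  proof -
    obtain h where h: "bij_betw h {..<card ?Q} ?Q"
      using ex_bij_betw_nat_finite[OF fin] by (auto simp: atLeast0LessThan)
    have "\<forall>i<card ?Q. h i \<in> topspace (T u)"
      using h QI by (auto simp: bij_betw_def topspace_T)
    then have "0 \<le> (\<Sum>i<card ?Q. \<Sum>j<card ?Q. 1 * 1 * K (h i, h j))"
      by (rule psd_kernel_nonneg[OF K])
    also have "\<dots> = (\<Sum>i<card ?Q. \<Sum>J'\<in>?Q. K (h i, J'))"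
      using sum.reindex_bij_betw[OF h, of "\<lambda>J'. K (h i, J')" for i] by simp
    also have "\<dots> = pair_sum u K Z"
      unfolding pair_sum_def by (rule sum.reindex_bij_betw[OF h, of "\<lambda>J. \<Sum>J'\<in>?Q. K (J, J')"])
    finally show ?thesis .
  qed
  then have "measure ?M \<in> psd_measures (T u)"
    using s int c by (auto simp: psd_measures_def psd_kernels_def)
  moreover have "is_adjoint_image (T u) F lam (measure ?M)"
    using s int op by (simp add: is_adjoint_image_def)
  ultimately show ?thesis by blast
qed

text \<open>The measure with mass \<open>1\<close> at each subset of \<open>Z\<close> of size at most \<open>2 t\<close> is feasible. For the second family
this truncation must contain all sets \<open>J \<union> J' \<union> {x}\<close>, of size at most \<open>2 (t - 1) + 1\<close>; this
is where \<open>1 \<le> t\<close> enters, and for empty \<open>X\<close> the family is empty.\<close>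

lemma las_le_card:
  assumes Z: "finite Z" "packing_independent X \<epsilon> Z" "is_covering X r Z" and t: "1 \<le> t \<or> X = {}"
  shows "las X r \<epsilon> t \<le> ereal (real (card Z))"
proof -
  let ?F = "small_subsets (2 * t) Z"
  define lam where "lam = point_masses (T (2 * t)) ?F (\<lambda>_. 1)"
  have F1: "finite ?F" using Z by (simp add: finite_small_subsets)
  have FI: "S \<in> I (2 * t)" if "S \<in> ?F" for S
    using that Z by (auto simp: small_subsets_def indep_sets_upto_def
        intro: finite_subset packing_independent_subset)
  note F2 = closedin_T_singleton[OF FI]
  have F3: "0 \<le> (1::real)" by simp
  have rad: "lam \<in> radon_measures (T (2 * t))"
    unfolding lam_def by (intro point_masses_radon F1 F2 F3)
  have int: "integral\<^sup>L lam f = (\<Sum>S\<in>?F. f S)" if "f \<in> borel_measurable lam" for f :: "'a set \<Rightarrow> real"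
    using integral_point_masses[OF F1 F2 F3, of f] that by (simp add: lam_def)
  have meas: "measure lam E = real (card (?F \<inter> E))" if "E \<in> borel_sets_of (T (2 * t))" for E
    using measure_point_masses[OF F1 F2 F3 that] by (simp add: lam_def)
  have "?F \<inter> {{}} = {{}}" by (auto simp: small_subsets_def)
  moreover have "{{}} \<in> borel_sets_of (T (2 * t))"
    by (intro borel_sets_of_closedin closedin_T_singleton empty_in_I)
  ultimately have e: "measure lam {{}} = 1" by (simp add: meas)
  have FZ: "?F \<subseteq> Pow Z" by (auto simp: small_subsets_def)
  have A: "\<exists>\<nu>\<in>psd_measures (T t). is_adjoint_image (T t) (A_op X \<epsilon> t) lam \<nu>"
  proof (rule adjoint_point_masses[OF Z(1,2), where c = 1])
    fix K assume "K \<in> sym_kernels (T t)"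
    then have "(\<integral>S. A_op X \<epsilon> t K S \<partial>lam) = (\<Sum>S\<in>?F. A_op X \<epsilon> t K S)"
      by (intro int A_op_measurable[OF rad])
    also have "\<dots> = pair_sum t K Z"
    proof (rule sum_A_op[OF Z(1,2) FZ])
      fix J J' assume "J \<in> small_subsets t Z" "J' \<in> small_subsets t Z"
      then show "J \<union> J' \<in> ?F" using card_Un_le[of J J'] by (auto simp: small_subsets_def)
    qed
    finally show "(\<integral>S. A_op X \<epsilon> t K S \<partial>lam) = 1 * pair_sum t K Z" by simp
  qed simp
  have B: "\<exists>\<nu>\<in>psd_measures (T (t - 1)). is_adjoint_image (T (t - 1)) (B_op X r \<epsilon> (t - 1) z) lam \<nu>"
    if z: "z \<in> X" for z
  proof (rule adjoint_point_masses[OF Z(1,2), where c = "real (card (Z \<inter> cball z r)) - 1"])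
    have t1: "1 \<le> t" using t z by auto
    have "Z \<inter> cball z r \<noteq> {}"
    proof -
      obtain x where "x \<in> Z" "z \<in> cball x r" using Z(3) z unfolding is_covering_def by blast
      then have "x \<in> Z \<inter> cball z r" by (simp add: dist_commute)
      then show ?thesis by blast
    qed
    then have "card (Z \<inter> cball z r) \<noteq> 0" using Z(1) by simp
    then show "0 \<le> real (card (Z \<inter> cball z r)) - 1" by linarith
    fix K assume "K \<in> sym_kernels (T (t - 1))"
    then have "(\<integral>S. B_op X r \<epsilon> (t - 1) z K S \<partial>lam) = (\<Sum>S\<in>?F. B_op X r \<epsilon> (t - 1) z K S)"
      by (intro int B_op_measurable[OF rad])
    also have "\<dots> = (real (card (Z \<inter> cball z r)) - 1) * pair_sum (t - 1) K Z"
    proof (rule sum_B_op[OF Z(1,2) FZ])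
      have *: "J \<union> J' \<union> A \<in> ?F" if "A \<subseteq> Z" "card A \<le> 1" "J \<in> small_subsets (t - 1) Z" "J' \<in> small_subsets (t - 1) Z"
        for A J J'
        using that t1 card_Un_le[of J J'] card_Un_le[of "J \<union> J'" A] by (auto simp: small_subsets_def)
      fix J J' assume J: "J \<in> small_subsets (t - 1) Z" "J' \<in> small_subsets (t - 1) Z"
      show "J \<union> J' \<in> ?F" using *[of "{}"] J by simp
      fix x assume "x \<in> Z"
      then show "J \<union> J' \<union> {x} \<in> ?F" using *[of "{x}"] J by simp
    qed
    finally show "(\<integral>S. B_op X r \<epsilon> (t - 1) z K S \<partial>lam)
      = (real (card (Z \<inter> cball z r)) - 1) * pair_sum (t - 1) K Z" .
  qed
  have "lam \<in> las_feasible X r \<epsilon> t"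
    using rad e A B by (simp add: las_feasible_def)
  then have "las X r \<epsilon> t \<le> ereal (measure lam (indep_singletons X \<epsilon>))"
    unfolding las_def by (rule INF_lower)
  also have "measure lam (indep_singletons X \<epsilon>) \<le> real (card Z)"
  proof (cases "indep_singletons X \<epsilon> \<in> borel_sets_of (T (2 * t))")
    case True
    have "?F \<inter> indep_singletons X \<epsilon> \<subseteq> (\<lambda>x. {x}) ` Z"
      by (auto simp: small_subsets_def indep_singletons_def card_1_singleton_iff)
    then have "card (?F \<inter> indep_singletons X \<epsilon>) \<le> card Z"
      using Z(1) by (meson card_image_le card_mono finite_imageI order_trans)
    then show ?thesis using True by (simp add: meas)
  next
    case False
    then have "indep_singletons X \<epsilon> \<notin> sets lam" using rad by (simp add: radon_measures_def)
    then show ?thesis by (simp add: measure_notin_sets)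
  qed
  finally show ?thesis by simp
qed

section \<open>Exactness at the packing number\<close>

text \<open>At the packing number both size bounds are void.\<close>

lemma T_double_alpha: "T (2 * packing_alpha X \<epsilon>) = T (packing_alpha X \<epsilon>)"
proof -
  have "I (2 * packing_alpha X \<epsilon>) = I (packing_alpha X \<epsilon>)"
    by (simp add: I_eq_alpha)
  then show ?thesis by (simp add: indep_topology_def indep_open_def[abs_def])
qed

lemma continuous_sqrt:
  "continuous_map (T n) euclideanreal \<psi> \<Longrightarrow> continuous_map (T n) euclideanreal (\<lambda>R. sqrt (\<psi> R))"
  unfolding continuous_map_near_iff by (auto intro: tendsto_real_sqrt)

lemma tendsto_mobius:
  assumes "finite S" "\<And>R. R \<subseteq> S \<Longrightarrow> (\<lambda>k. \<psi> k R) \<longlonglongrightarrow> \<phi> R"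
  shows "(\<lambda>k. mobius (\<psi> k) S) \<longlonglongrightarrow> mobius \<phi> S"
  unfolding mobius_def by (intro tendsto_intros assms) auto

text \<open>A Moebius transform on \<open>I n\<close> is a sum of at most \<open>2 ^ n\<close> terms, so pointwise bounded convergence of the
functions passes to their transforms.\<close>

lemma tendsto_integral_mobius:
  assumes lam: "lam \<in> radon_measures (T n)"
    and meas: "\<And>k. mobius (\<psi> k) \<in> borel_measurable lam"
    and lim: "\<And>R. R \<in> I n \<Longrightarrow> (\<lambda>k. \<psi> k R) \<longlonglongrightarrow> \<phi> R"
    and bound: "\<And>k R. R \<in> I n \<Longrightarrow> \<bar>\<psi> k R\<bar> \<le> b"
  shows "(\<lambda>k. \<integral>S. mobius (\<psi> k) S \<partial>lam) \<longlonglongrightarrow> (\<integral>S. mobius \<phi> S \<partial>lam)"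
proof (rule integral_dominated_convergence[where w = "\<lambda>_. 2 ^ n * b"])
  interpret finite_measure lam using lam by (simp add: radon_measures_def)
  note sp = space_radon[OF lam]
  have L: "(\<lambda>k. mobius (\<psi> k) S) \<longlonglongrightarrow> mobius \<phi> S" if S: "S \<in> space lam" for S
  proof (rule tendsto_mobius)
    show "finite S" using S I_finite unfolding sp by blast
    show "(\<lambda>k. \<psi> k R) \<longlonglongrightarrow> \<phi> R" if "R \<subseteq> S" for R
      using I_subset_same[OF _ that] S lim unfolding sp by blast
  qed
  then show "AE S in lam. (\<lambda>k. mobius (\<psi> k) S) \<longlonglongrightarrow> mobius \<phi> S" by simp
  show "mobius \<phi> \<in> borel_measurable lam"
    by (rule borel_measurable_LIMSEQ_real[OF L meas])
  show "integrable lam (\<lambda>_. 2 ^ n * b)" by simp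
  have "\<bar>mobius (\<psi> k) S\<bar> \<le> 2 ^ n * b" if S: "S \<in> I n" for k S
  proof -
    have b: "\<bar>\<psi> k R\<bar> \<le> b" if "R \<subseteq> S" for R
      by (rule bound[OF I_subset_same[OF S that]])
    then have "0 \<le> b" by (metis abs_ge_zero order_refl order_trans)
    have "\<bar>mobius (\<psi> k) S\<bar> \<le> 2 ^ card S * b"
      by (rule abs_mobius_le[OF I_finite[OF S] b])
    also have "\<dots> \<le> 2 ^ n * b"
      using S \<open>0 \<le> b\<close> by (intro mult_right_mono power_increasing) (auto simp: indep_sets_upto_def)
    finally show ?thesis .
  qed
  then show "AE S in lam. norm (mobius (\<psi> k) S) \<le> 2 ^ n * b" for k
    by (intro AE_I2) (simp add: sp)
qed (rule meas)

text \<open>A continuous lower approximation of the indicator of the sets that miss \<open>cball z r\<close>; for \<open>k \<ge> 1\<close> it is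
positive at all of these sets.\<close>

definition gap :: "'a \<Rightarrow> real \<Rightarrow> nat \<Rightarrow> 'a set \<Rightarrow> real" where
  "gap z r k R = (\<Prod>x\<in>R. 1 - bump z r k x)"

lemma gap_continuous: "continuous_map (T n) euclideanreal (gap z r k)"
  unfolding gap_def by (intro continuous_prod_points continuous_intros bump_continuous)

lemma gap_nonneg: "0 \<le> gap z r k R"
  unfolding gap_def by (intro prod_nonneg) (simp add: bump_bounds)

lemma gap_mono: "j \<le> k \<Longrightarrow> gap z r j R \<le> gap z r k R"
  unfolding gap_def by (intro prod_mono) (auto simp: bump_bounds bump_antimono)

lemma gap_le_1: "gap z r k R \<le> 1"
  unfolding gap_def by (intro prod_le_1) (auto simp: bump_bounds)

lemma gap_tendsto:
  assumes "finite R"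
  shows "(\<lambda>k. gap z r k R) \<longlonglongrightarrow> of_bool (R \<inter> cball z r = {})"
proof -
  have "(\<lambda>k. gap z r k R) \<longlonglongrightarrow> (\<Prod>x\<in>R. 1 - of_bool (x \<in> cball z r))"
    unfolding gap_def by (intro tendsto_intros bump_tendsto)
  also have "(\<Prod>x\<in>R. 1 - of_bool (x \<in> cball z r)) = (of_bool (R \<inter> cball z r = {}) :: real)"
    using assms by (auto simp: of_bool_def disjoint_iff intro!: prod.neutral)
  finally show ?thesis .
qed

lemma gap_pos:
  assumes "R \<inter> cball z r = {}"
  shows "0 < gap z r 1 R"
  unfolding gap_def using assms by (intro prod_pos) (auto simp: bump_def disjoint_iff)

text \<open>A continuous approximation of \<open>cut_coeff a (card J)\<close> times the indicator of \<open>J \<subseteq> cball z r\<close>.\<close>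

definition cut_function :: "nat \<Rightarrow> 'a \<Rightarrow> real \<Rightarrow> nat \<Rightarrow> 'a set \<Rightarrow> real" where
  "cut_function a z r k J = cut_coeff a (card J) * (\<Prod>x\<in>J. bump z r k x)"

lemma cut_function_continuous: "continuous_map (T n) euclideanreal (cut_function a z r k)"
  unfolding cut_function_def
  by (intro continuous_map_real_mult continuous_card continuous_prod_points bump_continuous)

lemma sum_cut_function_bound:
  assumes "R \<in> I a"
  shows "\<bar>\<Sum>J\<in>small_subsets (a - 1) R. cut_function a z r k J\<bar> \<le> 2 ^ a"
proof -
  have R: "finite R" "card R \<le> a" using assms by (auto simp: indep_sets_upto_def)
  have "\<bar>\<Sum>J\<in>small_subsets (a - 1) R. cut_function a z r k J\<bar> \<le> (\<Sum>J\<in>small_subsets (a - 1) R. 1)"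
  proof (rule order_trans[OF sum_abs sum_mono])
    fix J assume "J \<in> small_subsets (a - 1) R"
    then have "\<bar>cut_coeff a (card J)\<bar> \<le> 1"
      by (intro abs_cut_coeff_le) (auto simp: small_subsets_def)
    moreover have "\<bar>\<Prod>x\<in>J. bump z r k x\<bar> \<le> 1"
      using prod_nonneg[of J "bump z r k"] by (auto simp: bump_bounds intro!: prod_le_1)
    ultimately show "\<bar>cut_function a z r k J\<bar> \<le> 1"
      by (simp add: cut_function_def abs_mult mult_le_one)
  qed
  also have "\<dots> \<le> real (card (Pow R))"
    using R by (auto simp: small_subsets_def intro!: card_mono)
  also have "\<dots> \<le> 2 ^ a"
    using R by (simp add: card_Pow)
  finally show ?thesis .
qed

text \<open>In the limit the square is \<open>1\<close> if \<open>R\<close> misses the ball, is multiplied by \<open>0\<close> if \<open>R\<close> has one point in it,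
and is \<open>0\<close> if \<open>R\<close> has more.\<close>

lemma cut_function_limit:
  assumes R: "R \<in> I a" and a: "1 \<le> a"
  shows "(\<lambda>k. (real (card (R \<inter> cball z r)) - 1)
      * (\<Sum>J\<in>small_subsets (a - 1) R. cut_function a z r k J)\<^sup>2)
    \<longlonglongrightarrow> - of_bool (R \<inter> cball z r = {})"
proof -
  let ?C = "cball z r"
  have fin: "finite R" "card R \<le> a" using R by (auto simp: indep_sets_upto_def)
  have "(\<lambda>k. (real (card (R \<inter> ?C)) - 1)
      * (\<Sum>J\<in>small_subsets (a - 1) R. cut_function a z r k J)\<^sup>2)
    \<longlonglongrightarrow> (real (card (R \<inter> ?C)) - 1)
      * (\<Sum>J\<in>small_subsets (a - 1) R. cut_coeff a (card J) * (\<Prod>x\<in>J. of_bool (x \<in> ?C)))\<^sup>2"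
    unfolding cut_function_def by (intro tendsto_intros bump_tendsto)
  also have "(real (card (R \<inter> ?C)) - 1)
      * (\<Sum>J\<in>small_subsets (a - 1) R. cut_coeff a (card J) * (\<Prod>x\<in>J. of_bool (x \<in> ?C)))\<^sup>2
    = - of_bool (R \<inter> ?C = {})"
    unfolding sum_cut_coeff[OF fin a] using fin(1) by (auto simp: of_bool_def)
  finally show ?thesis .
qed

context
  fixes lam :: "'a set measure" and r :: real and a :: nat
  assumes a_def: "a = packing_alpha X \<epsilon>" and a1: "1 \<le> a"
    and feas: "lam \<in> las_feasible X r \<epsilon> a"
begin

lemma lam_radon: "lam \<in> radon_measures (T a)"
  using feas T_double_alpha by (simp add: las_feasible_def a_def)

lemma integrable_mobius:
  "continuous_map (T a) euclideanreal \<psi> \<Longrightarrow> integrable lam (mobius \<psi>)"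
  by (intro continuous_map_integrable[OF compact_space_T lam_radon] continuous_mobius)

text \<open>With \<open>f\<close> the Moebius transform of \<open>sqrt \<psi>\<close>, the sum of \<open>f\<close> over the subsets of \<open>R\<close> is \<open>sqrt (\<psi> R)\<close>, so
\<open>pair_sum a K R = \<psi> R\<close> for the rank one kernel \<open>K\<close> of \<open>f\<close>. Here \<open>pair_sum a K R\<close> involves all subsets of \<open>R\<close>,
because \<open>a\<close> is the packing number.\<close>

lemma mobius_integral_nonneg:
  assumes \<psi>: "continuous_map (T a) euclideanreal \<psi>" and nn: "\<And>S. S \<in> I a \<Longrightarrow> 0 \<le> \<psi> S"
  shows "0 \<le> (\<integral>S. mobius \<psi> S \<partial>lam)"
proof -
  define f where "f = mobius (\<lambda>R. sqrt (\<psi> R))"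
  define K where "K = (\<lambda>(J, J'). f J * f J')"
  have "continuous_map (T a) euclideanreal f"
    unfolding f_def by (intro continuous_mobius continuous_sqrt \<psi>)
  then have K: "K \<in> psd_kernels (T a)"
    unfolding K_def by (rule rank_one_psd_kernel)
  obtain \<nu> where \<nu>: "\<nu> \<in> psd_measures (T a)" "is_adjoint_image (T a) (A_op X \<epsilon> a) lam \<nu>"
    using feas by (auto simp: las_feasible_def)
  have "0 \<le> signed_integral (prod_topology (T a) (T a)) K \<nu>"
    using \<nu>(1) K by (simp add: psd_measures_def)
  also have "\<dots> = (\<integral>S. A_op X \<epsilon> a K S \<partial>lam)"
    using \<nu>(2) K by (simp add: is_adjoint_image_def psd_kernels_def)
  also have "\<dots> = (\<integral>S. mobius \<psi> S \<partial>lam)"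
  proof (rule Bochner_Integration.integral_cong[OF refl])
    fix S assume "S \<in> space lam"
    then have S: "S \<in> I a" by (simp add: space_radon[OF lam_radon])
    then have S': "finite S" "packing_independent X \<epsilon> S" by (auto simp: indep_sets_upto_def)
    have "pair_sum a K R = \<psi> R" if "R \<subseteq> S" for R
    proof -
      have R: "R \<in> I a" by (rule I_subset_same[OF S that])
      have "small_subsets a R = Pow R"
        using I_subset_same[OF R] by (auto simp: small_subsets_def indep_sets_upto_def)
      then have "pair_sum a K R = (\<Sum>J\<in>Pow R. f J)\<^sup>2"
        by (simp add: K_def pair_sum_rank_one)
      also have "\<dots> = \<psi> R"
        using nn[OF R] by (simp add: f_def sum_mobius[OF I_finite[OF R]])
      finally show ?thesis .
    qed
    then show "A_op X \<epsilon> a K S = mobius \<psi> S"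
      unfolding A_op_eq_mobius[OF S'] by (rule mobius_cong)
  qed
  finally show ?thesis .
qed

text \<open>The constraint for \<open>z\<close>, applied to the rank one kernels of the cut functions, in the limit.\<close>

lemma mobius_integral_uncovered_nonpos:
  assumes z: "z \<in> X"
  shows "(\<integral>S. mobius (\<lambda>R. of_bool (R \<inter> cball z r = {})) S \<partial>lam) \<le> 0"
proof -
  let ?\<psi> = "\<lambda>k R. (real (card (R \<inter> cball z r)) - 1)
      * (\<Sum>J\<in>small_subsets (a - 1) R. cut_function a z r k J)\<^sup>2"
  define K where "K k = (\<lambda>(J, J'). cut_function a z r k J * cut_function a z r k J')" for k
  have K: "K k \<in> psd_kernels (T (a - 1))" for k
    unfolding K_def by (rule rank_one_psd_kernel[OF cut_function_continuous])
  have B: "B_op X r \<epsilon> (a - 1) z (K k) S = mobius (?\<psi> k) S" if "S \<in> space lam" for k S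
  proof -
    have S: "finite S" "packing_independent X \<epsilon> S"
      using that by (auto simp: space_radon[OF lam_radon] indep_sets_upto_def)
    show ?thesis
      unfolding B_op_eq_mobius[OF S] by (simp add: K_def pair_sum_rank_one)
  qed
  have meas: "mobius (?\<psi> k) \<in> borel_measurable lam" for k
    using B_op_measurable[OF lam_radon, of "K k" "a - 1" r z] K[of k] B
    by (simp add: psd_kernels_def cong: measurable_cong)
  obtain \<nu> where \<nu>: "\<nu> \<in> psd_measures (T (a - 1))"
      "is_adjoint_image (T (a - 1)) (B_op X r \<epsilon> (a - 1) z) lam \<nu>"
    using las_feasible_B_op[OF feas z] by (rule bexE)
  have nn: "0 \<le> (\<integral>S. mobius (?\<psi> k) S \<partial>lam)" for k
  proof -
    have "0 \<le> signed_integral (prod_topology (T (a - 1)) (T (a - 1))) (K k) \<nu>"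
      using \<nu>(1) K by (simp add: psd_measures_def)
    also have "\<dots> = (\<integral>S. B_op X r \<epsilon> (a - 1) z (K k) S \<partial>lam)"
      using \<nu>(2) K by (simp add: is_adjoint_image_def psd_kernels_def)
    also have "\<dots> = (\<integral>S. mobius (?\<psi> k) S \<partial>lam)"
      by (rule Bochner_Integration.integral_cong[OF refl B])
    finally show ?thesis .
  qed
  have "(\<lambda>k. \<integral>S. mobius (?\<psi> k) S \<partial>lam)
      \<longlonglongrightarrow> (\<integral>S. mobius (\<lambda>R. - of_bool (R \<inter> cball z r = {})) S \<partial>lam)"
  proof (rule tendsto_integral_mobius[OF lam_radon meas])
    fix R assume R: "R \<in> I a"
    show "(\<lambda>k. ?\<psi> k R) \<longlonglongrightarrow> - of_bool (R \<inter> cball z r = {})"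
      by (rule cut_function_limit[OF R a1])
    fix k
    have "card (R \<inter> cball z r) \<le> a"
      using I_subset_same[OF R, of "R \<inter> cball z r"] by (auto simp: indep_sets_upto_def)
    then have "\<bar>real (card (R \<inter> cball z r)) - 1\<bar> \<le> real a + 1" by linarith
    moreover have "(\<Sum>J\<in>small_subsets (a - 1) R. cut_function a z r k J)\<^sup>2 \<le> (2 ^ a)\<^sup>2"
      using sum_cut_function_bound[OF R] by (simp add: abs_le_square_iff[symmetric])
    ultimately show "\<bar>?\<psi> k R\<bar> \<le> (real a + 1) * (2 ^ a)\<^sup>2"
      unfolding abs_mult by (intro mult_mono) auto
  qed
  then have "0 \<le> (\<integral>S. mobius (\<lambda>R. - of_bool (R \<inter> cball z r = {})) S \<partial>lam)"
    by (rule LIMSEQ_le_const) (use nn in auto)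
  also have "\<dots> = - (\<integral>S. mobius (\<lambda>R. of_bool (R \<inter> cball z r = {})) S \<partial>lam)"
    using mobius_cmult[of "-1" "\<lambda>R. of_bool (R \<inter> cball z r = {})"] by simp
  finally show ?thesis by simp
qed

text \<open>The functions \<open>gap z r k\<close> increase with \<open>k\<close> to the indicator of missing the ball, and \<open>\<Lambda>\<close> is monotone on
continuous functions.\<close>

lemma mobius_integral_gap_nonpos:
  assumes z: "z \<in> X"
  shows "(\<integral>S. mobius (gap z r 1) S \<partial>lam) \<le> 0"
proof -
  have "(\<lambda>k. \<integral>S. mobius (gap z r k) S \<partial>lam)
      \<longlonglongrightarrow> (\<integral>S. mobius (\<lambda>R. of_bool (R \<inter> cball z r = {})) S \<partial>lam)"
  proof (rule tendsto_integral_mobius[OF lam_radon, where b = 1])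
    show "mobius (gap z r k) \<in> borel_measurable lam" for k
      by (intro continuous_map_borel_measurable[OF lam_radon] continuous_mobius gap_continuous)
    show "(\<lambda>k. gap z r k R) \<longlonglongrightarrow> of_bool (R \<inter> cball z r = {})" if "R \<in> I a" for R
      by (rule gap_tendsto[OF I_finite[OF that]])
    show "\<bar>gap z r k R\<bar> \<le> 1" for k R
      using gap_nonneg[of z r k R] gap_le_1[of z r k R] by simp
  qed
  moreover have "(\<integral>S. mobius (gap z r 1) S \<partial>lam) \<le> (\<integral>S. mobius (gap z r k) S \<partial>lam)" if "1 \<le> k" for k
  proof -
    have "0 \<le> (\<integral>S. mobius (\<lambda>R. gap z r k R + (-1) * gap z r 1 R) S \<partial>lam)"
      by (intro mobius_integral_nonneg continuous_map_add continuous_map_real_mult gap_continuous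
          continuous_map_const[THEN iffD2]) (use gap_mono[OF that] in auto)
    also have "\<dots> = (\<integral>S. mobius (gap z r k) S \<partial>lam) - (\<integral>S. mobius (gap z r 1) S \<partial>lam)"
      unfolding mobius_add mobius_cmult
      by (simp add: integrable_mobius[OF gap_continuous])
    finally show ?thesis by simp
  qed
  ultimately have "(\<integral>S. mobius (gap z r 1) S \<partial>lam)
      \<le> (\<integral>S. mobius (\<lambda>R. of_bool (R \<inter> cball z r = {})) S \<partial>lam)"
    by (intro LIMSEQ_le_const) auto
  then show ?thesis using mobius_integral_uncovered_nonpos[OF z] by linarith
qed

lemma mobius_integral_one: "(\<integral>S. mobius (\<lambda>_. 1) S \<partial>lam) = 1"
proof -
  have "(\<integral>S. mobius (\<lambda>_. 1) S \<partial>lam) = (\<integral>S. indicator {{}} S \<partial>lam)"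
    by (rule Bochner_Integration.integral_cong[OF refl])
      (simp add: space_radon[OF lam_radon] mobius_one I_finite indicator_def)
  also have "\<dots> = measure lam ({{}} \<inter> space lam)" by simp
  also have "{{}} \<inter> space lam = {{}}" by (simp add: space_radon[OF lam_radon] empty_in_I)
  finally show ?thesis using feas by (simp add: las_feasible_def)
qed

lemma mobius_integral_card:
  "(\<integral>S. mobius (\<lambda>R. real (card R)) S \<partial>lam) = measure lam (indep_singletons X \<epsilon>)"
proof -
  have "(\<integral>S. mobius (\<lambda>R. real (card R)) S \<partial>lam) = (\<integral>S. indicator (indep_singletons X \<epsilon>) S \<partial>lam)"
  proof (rule Bochner_Integration.integral_cong[OF refl])
    fix S assume "S \<in> space lam"
    then have "S \<in> I a" by (simp add: space_radon[OF lam_radon])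
    then show "mobius (\<lambda>R. real (card R)) S = indicator (indep_singletons X \<epsilon>) S"
      by (simp add: mobius_card I_finite indicator_def) (simp add: indep_singletons_def indep_sets_upto_def)
  qed
  also have "\<dots> = measure lam (indep_singletons X \<epsilon> \<inter> space lam)" by simp
  also have "indep_singletons X \<epsilon> \<inter> space lam = indep_singletons X \<epsilon>"
    using a1 by (auto simp: space_radon[OF lam_radon] indep_singletons_def indep_sets_upto_def card_1_singleton_iff)
  finally show ?thesis .
qed

lemma not_covering_if_small:
  assumes "S \<in> I a" "card S < covering_number X r"
  shows "\<exists>z\<in>X. S \<inter> cball z r = {}"
proof -
  have S: "finite S" "S \<subseteq> X" using assms by (auto simp: indep_sets_upto_def packing_independent_def)
  have "\<not> is_covering X r S"
  proof
    assume "is_covering X r S"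
    then have "covering_number X r \<le> card S"
      unfolding covering_number_def using S by (intro Least_le) auto
    with assms show False by simp
  qed
  then obtain z where "z \<in> X" "\<forall>x\<in>S. z \<notin> cball x r"
    using S unfolding is_covering_def by blast
  then show ?thesis by (intro bexI[of _ z]) (auto simp: dist_commute)
qed

text \<open>For each independent set \<open>S\<close> some \<open>card S - covering_number X r + k * gap z r 1 S\<close> exceeds \<open>- e\<close>: with
\<open>k = 0\<close> if \<open>S\<close> has enough points, and otherwise with \<open>z\<close> not covered by \<open>S\<close> and \<open>k\<close> large. By
compactness finitely many \<open>(z, k)\<close> serve all \<open>S\<close>, and since the gap functions are nonnegative their sum
serves all \<open>S\<close> at once. Positivity of \<open>\<Lambda>\<close> and its nonpositive values on gap functions give the bound.\<close>

lemma covering_number_le_measure: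
  "real (covering_number X r) \<le> measure lam (indep_singletons X \<epsilon>)"
proof (rule field_le_epsilon)
  fix e :: real assume e: "0 < e"
  let ?N = "real (covering_number X r)"
  let ?\<phi> = "\<lambda>p R. real (card R) - ?N + real (snd p) * gap (fst p) r 1 R"
  define U where "U p = {S \<in> topspace (T a). ?\<phi> p S \<in> {- e<..}}" for p :: "'a \<times> nat"
  have contc: "continuous_map (T a) euclideanreal (\<lambda>R. real (card R) - ?N)"
    by (rule continuous_card[of _ "\<lambda>n. real n - ?N"])
  have contg: "continuous_map (T a) euclideanreal (\<lambda>R. real (snd p) * gap (fst p) r 1 R)" for p :: "'a \<times> nat"
    by (intro continuous_map_real_mult gap_continuous continuous_map_const[THEN iffD2]) auto
  have openU: "openin (T a) (U p)" for p
    unfolding U_def by (intro openin_continuous_map_preimage[OF continuous_map_add[OF contc contg]]) auto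
  have cover: "I a \<subseteq> (\<Union>p\<in>X \<times> UNIV. U p)"
  proof
    fix S assume S: "S \<in> I a"
    show "S \<in> (\<Union>p\<in>X \<times> UNIV. U p)"
    proof (cases "card S < covering_number X r")
      case True
      then obtain z where z: "z \<in> X" "S \<inter> cball z r = {}"
        using not_covering_if_small[OF S] by blast
      obtain k where "?N < real k * gap z r 1 S"
        using reals_Archimedean3[OF gap_pos[OF z(2)]] by blast
      then have "S \<in> U (z, k)" using S e by (simp add: U_def topspace_T)
      then show ?thesis using z by blast
    next
      case False
      obtain z where z: "z \<in> X" using a1 alpha_pos_iff a_def by auto
      have "S \<in> U (z, 0)" using S e False by (simp add: U_def topspace_T)
      then show ?thesis using z by blast
    qed
  qed
  have "compactin (T a) (I a)"
    using compact_space_T[of a] by (simp add: compact_space_def topspace_T)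
  then obtain \<F> where \<F>: "finite \<F>" "\<F> \<subseteq> U ` (X \<times> UNIV)" "I a \<subseteq> \<Union>\<F>"
    using compactinD[of "T a" "I a" "U ` (X \<times> UNIV)"] openU cover by blast
  obtain P where P: "P \<subseteq> X \<times> UNIV" "finite P" "\<F> = U ` P"
    using finite_subset_image[OF \<F>(1,2)] by blast
  then have coverP: "I a \<subseteq> (\<Union>p\<in>P. U p)" using \<F>(3) by simp
  define g where "g R = (\<Sum>p\<in>P. real (snd p) * gap (fst p) r 1 R)" for R
  have contS: "continuous_map (T a) euclideanreal g"
    unfolding g_def by (rule continuous_map_sum[OF P(2) contg])
  have "0 \<le> (\<integral>S. mobius (\<lambda>R. real (card R) + ((e - ?N) * 1 + g R)) S \<partial>lam)"
  proof (rule mobius_integral_nonneg)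
    have "continuous_map (T a) euclideanreal (\<lambda>R. (real (card R) + (e - ?N)) + g R)"
      by (intro continuous_map_add[OF _ contS] continuous_card[of _ "\<lambda>n. real n + (e - ?N)"])
    then show "continuous_map (T a) euclideanreal (\<lambda>R. real (card R) + ((e - ?N) * 1 + g R))"
      by (simp add: add.assoc)
    fix S assume "S \<in> I a"
    then obtain p where p: "p \<in> P" "S \<in> U p" using coverP by blast
    have "real (snd p) * gap (fst p) r 1 S \<le> g S"
      unfolding g_def using p P by (intro member_le_sum) (auto simp: gap_nonneg)
    moreover have "- e < real (card S) - ?N + real (snd p) * gap (fst p) r 1 S"
      using p by (simp add: U_def)
    ultimately show "0 \<le> real (card S) + ((e - ?N) * 1 + g S)" by simp
  qed
  also have "\<dots> = (\<integral>S. mobius (\<lambda>R. real (card R)) S \<partial>lam)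
      + ((e - ?N) * (\<integral>S. mobius (\<lambda>_. 1) S \<partial>lam) + (\<integral>S. mobius g S \<partial>lam))"
    unfolding mobius_add mobius_cmult
    using integrable_mobius[OF continuous_card[of _ real]] integrable_mobius[OF contS]
      integrable_mobius[OF continuous_card[of _ "\<lambda>_. 1"]]
    by simp
  also have "(\<integral>S. mobius g S \<partial>lam) = (\<Sum>p\<in>P. real (snd p) * (\<integral>S. mobius (gap (fst p) r 1) S \<partial>lam))"
    unfolding g_def mobius_sum mobius_cmult
    by (simp add: integrable_mobius[OF gap_continuous])
  also have "\<dots> \<le> 0"
    using P mobius_integral_gap_nonpos by (intro sum_nonpos mult_nonneg_nonpos) auto
  finally show "?N \<le> measure lam (indep_singletons X \<epsilon>) + e"
    by (simp add: mobius_integral_one mobius_integral_card)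
qed

end

end

section \<open>The covering hierarchy\<close>

theorem theorem4p2:
  fixes X :: "'a::metric_space set" and r \<epsilon> :: real
  assumes "compact X" and "r > 0" and "\<epsilon> > 0"
    and "\<exists>Z. optimal_covering X r Z \<and> packing_independent X \<epsilon> Z"
  shows "(\<forall>s t. 1 \<le> s \<and> s \<le> t \<longrightarrow> las X r \<epsilon> s \<le> las X r \<epsilon> t)
    \<and> (\<forall>t\<ge>1. las X r \<epsilon> t \<le> ereal (real (covering_number X r)))
    \<and> las X r \<epsilon> (packing_alpha X \<epsilon>) = ereal (real (covering_number X r))"
proof (intro conjI allI impI)
  interpret compact_packing X \<epsilon> using assms by unfold_locales
  obtain Z where Z: "finite Z" "packing_independent X \<epsilon> Z" "is_covering X r Z"
    "card Z = covering_number X r"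
    using assms(4) by (auto simp: optimal_covering_def)
  show "las X r \<epsilon> s \<le> las X r \<epsilon> t" if "1 \<le> s \<and> s \<le> t" for s t
    using las_mono that by blast
  have upper: "las X r \<epsilon> t \<le> ereal (real (covering_number X r))" if "1 \<le> t \<or> X = {}" for t
    using las_le_card[OF Z(1-3) that] by (simp add: Z(4))
  then show "las X r \<epsilon> t \<le> ereal (real (covering_number X r))" if "1 \<le> t" for t
    using that by blast
  \<comment> \<open>If \<open>X\<close> is empty, the packing number is \<open>0\<close>, and so is the covering number.\<close>
  show "las X r \<epsilon> (packing_alpha X \<epsilon>) = ereal (real (covering_number X r))"
  proof (rule antisym)
    show "las X r \<epsilon> (packing_alpha X \<epsilon>) \<le> ereal (real (covering_number X r))"
      using upper alpha_pos_iff by blast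
    show "ereal (real (covering_number X r)) \<le> las X r \<epsilon> (packing_alpha X \<epsilon>)"
      unfolding las_def
    proof (rule INF_greatest)
      fix lam assume lam: "lam \<in> las_feasible X r \<epsilon> (packing_alpha X \<epsilon>)"
      have "real (covering_number X r) \<le> measure lam (indep_singletons X \<epsilon>)"
      proof (cases "X = {}")
        case True
        then have "card Z = 0" using Z by (auto simp: is_covering_def)
        then show ?thesis using Z(4) by simp
      next
        case False
        then show ?thesis
          using covering_number_le_measure[OF refl _ lam] alpha_pos_iff by blast
      qed
      then show "ereal (real (covering_number X r)) \<le> ereal (measure lam (indep_singletons X \<epsilon>))"
        by simp
    qed
  qed
qed

end
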